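(* Let $1\le p<\infty$. There exist two upper frequently hypercyclic weighted shifts $B_v$ and $B_w$ on $\ell^p(\mathbb{N})$ such that $B_v$ and $B_w$ are disjoint reiteratively hypercyclic but not disjoint upper frequently hypercyclic.
   Context: $\mathbb{N}=\{1,2,\dots\}$; $\ell^p(\mathbb{N})$ is over $\mathbb{K}=\mathbb{R}$ or $\mathbb{C}$ with canonical basis $(e_n)_{n\ge1}$. For a bounded weight sequence $w=(w_n)_{n\ge1}$ of scalars, the unilateral weighted (backward) shift is $B_w(e_1)=0$, $B_w(e_n)=w_ne_{n-1}$ for $n\ge2$. For $A\subset\mathbb{N}$: $\overline{\mathrm{dens}}\,A=\limsup_{M\to\infty}\frac{\mathrm{card}\{n\le M:n\in A\}}{M}$, $\overline{\mathrm{Bd}}\,A=\limsup_{M\to\infty}\max_{k\ge1}\frac{\mathrm{card}(A\cap\{k+1,\dots,k+M\})}{M}$. An operator $T$ on $X$ is upper frequently hypercyclic if there is $x\in X$ such that $\overline{\mathrm{dens}}\{n:T^nx\in U\}>0$ for every non-empty open $U\subset X$. Operators $T_1,T_2$ on $X$ are disjoint upper frequently hypercyclic (resp. disjoint reiteratively hypercyclic) if there is $x\in X$ such that for all non-empty open $V_1,V_2\subset X$ the set $\{n:T_1^nx\in V_1\text{ and }T_2^nx\in V_2\}$ has positive upper density (resp. positive upper Banach density). *)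

theory Defs
  imports "HOL-Analysis.Analysis"
begin

section \<open>The sequence spaces and weighted shifts\<close>

text \<open>
  Sequences indexed by \<open>{1, 2, \<dots>}\<close> are functions on \<^typ>\<open>nat\<close> whose value at the unused index
  \<open>0\<close> is \<open>0\<close>. The scalar type \<open>'a\<close> is meant to be \<^typ>\<open>real\<close> or \<^typ>\<open>complex\<close>.
\<close>

definition lp_space :: "real \<Rightarrow> (nat \<Rightarrow> 'a::real_normed_field) set" where
  "lp_space p = {x. x 0 = 0 \<and> (\<lambda>n. norm (x n) powr p) summable_on {1..}}"

definition lp_norm :: "real \<Rightarrow> (nat \<Rightarrow> 'a::real_normed_field) \<Rightarrow> real" where
  "lp_norm p x = (\<Sum>\<^sub>\<infinity>n\<in>{1..}. norm (x n) powr p) powr (1 / p)"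

definition lp_dist :: "real \<Rightarrow> (nat \<Rightarrow> 'a::real_normed_field) \<Rightarrow> (nat \<Rightarrow> 'a) \<Rightarrow> real" where
  "lp_dist p x y = lp_norm p (\<lambda>n. x n - y n)"

definition lp_topology :: "real \<Rightarrow> (nat \<Rightarrow> 'a::real_normed_field) topology" where
  "lp_topology p = Metric_space.mtopology (lp_space p) (lp_dist p)"

definition basis_vec :: "nat \<Rightarrow> nat \<Rightarrow> 'a::real_normed_field" where
  "basis_vec k = (\<lambda>n. if n = k then 1 else 0)"

text \<open>
  The bounded operator with \<open>e\<^sub>1 \<mapsto> 0\<close> and \<open>e\<^sub>n \<mapsto> w\<^sub>n e\<^sub>n\<^sub>-\<^sub>1\<close> for \<open>n \<ge> 2\<close>, written in coordinates;
  the lemmas below confirm that it is a bounded linear operator with these values.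
\<close>

definition weighted_shift :: "(nat \<Rightarrow> 'a::real_normed_field) \<Rightarrow> (nat \<Rightarrow> 'a) \<Rightarrow> (nat \<Rightarrow> 'a)" where
  "weighted_shift w x = (\<lambda>n. if n = 0 then 0 else w (Suc n) * x (Suc n))"


section \<open>Densities\<close>

definition upper_density :: "nat set \<Rightarrow> ereal" where
  "upper_density A = limsup (\<lambda>M. ereal (real (card (A \<inter> {1..M})) / real M))"

text \<open>The maximum is over an infinite index set, but of a function with values in \<open>{0..M}\<close>.\<close>

definition upper_Banach_density :: "nat set \<Rightarrow> ereal" where
  "upper_Banach_density A =
     limsup (\<lambda>M. ereal (real (MAX k\<in>{1..}. card (A \<inter> {k + 1..k + M})) / real M))"

lemma finite_window_counts: "finite ((\<lambda>k. card (A \<inter> {k + 1..k + M})) ` {1::nat..})"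
proof (rule finite_subset)
  show "(\<lambda>k. card (A \<inter> {k + 1..k + M})) ` {1::nat..} \<subseteq> {..M}"
  proof clarsimp
    fix k :: nat
    have "card (A \<inter> {Suc k..k + M}) \<le> card {Suc k..k + M}"
      by (intro card_mono) auto
    then show "card (A \<inter> {Suc k..k + M}) \<le> M" by simp
  qed
qed simp


section \<open>Hypercyclicity notions\<close>

text \<open>
  The index \<open>n = 0\<close> may belong to the return sets below; neither density counts it.
\<close>

definition upper_freq_hypercyclic :: "'x topology \<Rightarrow> ('x \<Rightarrow> 'x) \<Rightarrow> bool" where
  "upper_freq_hypercyclic X T \<longleftrightarrow>
     (\<exists>x\<in>topspace X. \<forall>U. openin X U \<and> U \<noteq> {} \<longrightarrow>
        upper_density {n. (T ^^ n) x \<in> U} > 0)"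

definition disjoint_upper_freq_hypercyclic ::
    "'x topology \<Rightarrow> ('x \<Rightarrow> 'x) \<Rightarrow> ('x \<Rightarrow> 'x) \<Rightarrow> bool" where
  "disjoint_upper_freq_hypercyclic X T1 T2 \<longleftrightarrow>
     (\<exists>x\<in>topspace X. \<forall>V1 V2. openin X V1 \<and> V1 \<noteq> {} \<and> openin X V2 \<and> V2 \<noteq> {} \<longrightarrow>
        upper_density {n. (T1 ^^ n) x \<in> V1 \<and> (T2 ^^ n) x \<in> V2} > 0)"

definition disjoint_reiteratively_hypercyclic ::
    "'x topology \<Rightarrow> ('x \<Rightarrow> 'x) \<Rightarrow> ('x \<Rightarrow> 'x) \<Rightarrow> bool" where
  "disjoint_reiteratively_hypercyclic X T1 T2 \<longleftrightarrow>
     (\<exists>x\<in>topspace X. \<forall>V1 V2. openin X V1 \<and> V1 \<noteq> {} \<and> openin X V2 \<and> V2 \<noteq> {} \<longrightarrow>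
        upper_Banach_density {n. (T1 ^^ n) x \<in> V1 \<and> (T2 ^^ n) x \<in> V2} > 0)"


section \<open>The metric and the shift are as intended\<close>

lemma powr_convex_ineq:
  fixes x y s t p :: real
  assumes p: "1 \<le> p" and "0 \<le> x" "0 \<le> y" and st: "0 < s" "0 < t" "s + t = 1"
  shows "(s * x + t * y) powr p \<le> s * x powr p + t * y powr p"
proof -
  have small: "u powr p \<le> u" if "0 < u" "u \<le> 1" for u :: real
    using powr_mono'[of 1 p u] that p by simp
  have scale: "(u * z) powr p \<le> u * z powr p" if "0 < u" "u \<le> 1" "0 \<le> z" for u z :: real
    using that small[of u] by (simp add: powr_mult mult_right_mono)
  consider "x = 0" | "y = 0" | "x > 0" "y > 0" using assms by linarith
  then show ?thesis
  proof cases
    case 1 then show ?thesis using scale[of t y] assms by simp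
  next
    case 2 then show ?thesis using scale[of s x] assms by simp
  next
    case 3
    have s: "s = 1 - t" using st by simp
    have "((1 - t) *\<^sub>R x + t *\<^sub>R y) powr p \<le> (1 - t) * x powr p + t * y powr p"
      by (rule convex_onD[OF powr_convex[OF p]]) (use 3 st in auto)
    then show ?thesis by (simp add: s)
  qed
qed

lemma lp_norm_nonneg: "0 \<le> lp_norm p x"
  by (simp add: lp_norm_def)

lemma lp_norm_powr:
  assumes "1 \<le> p"
  shows "lp_norm p x powr p = (\<Sum>\<^sub>\<infinity>n\<in>{1..}. norm (x n) powr p)"
proof -
  have "0 \<le> (\<Sum>\<^sub>\<infinity>n\<in>{1..}. norm (x n) powr p)" by (intro infsum_nonneg) simp
  then show ?thesis using assms by (simp add: lp_norm_def powr_powr)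
qed

lemma lp_norm_eq_0:
  assumes "1 \<le> p" "x \<in> lp_space p" "lp_norm p x = 0"
  shows "x n = 0"
proof (cases "n = 0")
  case False
  have "(\<Sum>\<^sub>\<infinity>n\<in>{1..}. norm (x n) powr p) = 0"
    using assms lp_norm_powr[of p x] by simp
  then have "norm (x n) powr p = 0"
    using False assms by (intro nonneg_infsum_le_0D[of _ "{1..}"]) (auto simp: lp_space_def)
  then show ?thesis by simp
qed (use assms in \<open>simp add: lp_space_def\<close>)

lemma Minkowski_aux:
  assumes p: "1 \<le> p" and x: "x \<in> lp_space p" and y: "y \<in> lp_space p"
    and z: "z 0 = 0" "\<And>n. norm (z n) \<le> norm (x n) + norm (y n)"
    and pos: "0 < lp_norm p x" "0 < lp_norm p y"
  shows "z \<in> lp_space p \<and> lp_norm p z \<le> lp_norm p x + lp_norm p y"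
proof -
  define a b where "a = lp_norm p x" and "b = lp_norm p y"
  define c where "c = a + b"
  have ab: "0 < a" "0 < b" "0 < c" using pos by (auto simp: a_def b_def c_def)
  define f where
    "f n = c powr p * (a / c * (norm (x n) powr p / a powr p) + b / c * (norm (y n) powr p / b powr p))" for n
  have hx: "((\<lambda>n. norm (x n) powr p) has_sum (a powr p)) {1..}"
    using x lp_norm_powr[OF p, of x] by (simp add: lp_space_def a_def has_sum_infsum)
  have hy: "((\<lambda>n. norm (y n) powr p) has_sum (b powr p)) {1..}"
    using y lp_norm_powr[OF p, of y] by (simp add: lp_space_def b_def has_sum_infsum)
  have "(f has_sum (c powr p * (a / c * (a powr p / a powr p) + b / c * (b powr p / b powr p)))) {1..}"
    unfolding f_def divide_inverse
    by (intro has_sum_cmult_right has_sum_add has_sum_cmult_left hx hy)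
  also have "c powr p * (a / c * (a powr p / a powr p) + b / c * (b powr p / b powr p)) = c powr p"
    using ab by (simp add: c_def add_divide_distrib[symmetric])
  finally have f: "(f has_sum (c powr p)) {1..}" .
  have le: "norm (z n) powr p \<le> f n" for n
  proof -
    have "norm (z n) powr p \<le> (norm (x n) + norm (y n)) powr p"
      using z p by (intro powr_mono2) auto
    also have "norm (x n) + norm (y n) = c * (a / c * (norm (x n) / a) + b / c * (norm (y n) / b))"
      using ab by (simp add: field_simps)
    also have "\<dots> powr p = c powr p * (a / c * (norm (x n) / a) + b / c * (norm (y n) / b)) powr p"
      using ab by (subst powr_mult) auto
    also have "\<dots> \<le> c powr p * (a / c * (norm (x n) / a) powr p + b / c * (norm (y n) / b) powr p)"
      using ab p by (intro mult_left_mono powr_convex_ineq)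
        (auto simp: c_def add_divide_distrib[symmetric])
    also have "\<dots> = f n" using ab by (simp add: f_def powr_divide)
    finally show ?thesis .
  qed
  have sz: "(\<lambda>n. norm (z n) powr p) summable_on {1..}"
    by (rule summable_on_comparison_test[OF has_sum_imp_summable[OF f]]) (use le in auto)
  have "(\<Sum>\<^sub>\<infinity>n\<in>{1..}. norm (z n) powr p) \<le> c powr p"
    using infsum_mono[OF sz has_sum_imp_summable[OF f] le] infsumI[OF f] by simp
  then have "lp_norm p z \<le> (c powr p) powr (1 / p)"
    unfolding lp_norm_def using p by (intro powr_mono2 infsum_nonneg) auto
  also have "\<dots> = a + b" using ab p by (simp add: powr_powr c_def)
  finally show ?thesis using sz z by (simp add: lp_space_def a_def b_def)
qed

lemma lp_dominated:
  assumes p: "1 \<le> p" and u: "u \<in> lp_space p" and z: "z 0 = 0" "\<And>n. norm (z n) \<le> norm (u n)"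
  shows "z \<in> lp_space p" "lp_norm p z \<le> lp_norm p u"
proof -
  have su: "(\<lambda>n. norm (u n) powr p) summable_on {1..}" using u by (simp add: lp_space_def)
  have lep: "norm (z n) powr p \<le> norm (u n) powr p" for n using z p by (intro powr_mono2) auto
  have sz: "(\<lambda>n. norm (z n) powr p) summable_on {1..}"
    by (rule summable_on_comparison_test[OF su]) (use lep in auto)
  show "z \<in> lp_space p" using sz z by (simp add: lp_space_def)
  show "lp_norm p z \<le> lp_norm p u" unfolding lp_norm_def
    using p infsum_mono[OF sz su lep] by (intro powr_mono2 infsum_nonneg) auto
qed

lemma Minkowski:
  assumes p: "1 \<le> p" and x: "x \<in> lp_space p" and y: "y \<in> lp_space p"
    and z: "z 0 = 0" "\<And>n. norm (z n) \<le> norm (x n) + norm (y n)"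
  shows "z \<in> lp_space p \<and> lp_norm p z \<le> lp_norm p x + lp_norm p y"
proof -
  consider "lp_norm p x = 0" | "lp_norm p y = 0" | "0 < lp_norm p x" "0 < lp_norm p y"
    using lp_norm_nonneg[of p x] lp_norm_nonneg[of p y] by linarith
  then show ?thesis
  proof cases
    case 1
    then have "norm (z n) \<le> norm (y n)" for n using z(2)[of n] lp_norm_eq_0[OF p x] by simp
    then show ?thesis using lp_dominated[of p y z, OF p y z(1)] 1 by simp
  next
    case 2
    then have "norm (z n) \<le> norm (x n)" for n using z(2)[of n] lp_norm_eq_0[OF p y] by simp
    then show ?thesis using lp_dominated[of p x z, OF p x z(1)] 2 by simp
  next
    case 3 then show ?thesis using Minkowski_aux[OF p x y z] by blast
  qed
qed

lemma lp_space_add: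
  assumes "1 \<le> p" "x \<in> lp_space p" "y \<in> lp_space p"
  shows "(\<lambda>n. x n + y n) \<in> lp_space p"
  using Minkowski[OF assms, of "\<lambda>n. x n + y n"] assms by (auto simp: lp_space_def norm_triangle_ineq)

lemma lp_space_diff:
  assumes "1 \<le> p" "x \<in> lp_space p" "y \<in> lp_space p"
  shows "(\<lambda>n. x n - y n) \<in> lp_space p"
  using Minkowski[OF assms, of "\<lambda>n. x n - y n"] assms by (auto simp: lp_space_def norm_triangle_ineq4)

lemma Metric_space_lp:
  assumes p: "1 \<le> p"
  shows "Metric_space (lp_space p) (lp_dist p :: (nat \<Rightarrow> 'a::real_normed_field) \<Rightarrow> _)"
proof
  fix x y z :: "nat \<Rightarrow> 'a"
  show "0 \<le> lp_dist p x y" by (simp add: lp_dist_def lp_norm_nonneg)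
  show "lp_dist p x y = lp_dist p y x"
    by (simp add: lp_dist_def lp_norm_def norm_minus_commute)
  assume x: "x \<in> lp_space p" and y: "y \<in> lp_space p"
  show "lp_dist p x y = 0 \<longleftrightarrow> x = y"
  proof
    assume "lp_dist p x y = 0"
    then have "x n - y n = 0" for n
      using lp_norm_eq_0[OF p lp_space_diff[OF p x y]] by (simp add: lp_dist_def)
    then show "x = y" by auto
  qed (simp add: lp_dist_def lp_norm_def)
  assume z: "z \<in> lp_space p"
  show "lp_dist p x z \<le> lp_dist p x y + lp_dist p y z"
    unfolding lp_dist_def
  proof (rule Minkowski[THEN conjunct2, OF p lp_space_diff[OF p x y] lp_space_diff[OF p y z]])
    show "x 0 - z 0 = 0" using x z by (simp add: lp_space_def)
    show "norm (x n - z n) \<le> norm (x n - y n) + norm (y n - z n)" for n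
      using norm_triangle_ineq[of "x n - y n" "y n - z n"] by simp
  qed
qed

lemma openin_lp_topology:
  assumes "1 \<le> p"
  shows "openin (lp_topology p) U \<longleftrightarrow>
    U \<subseteq> lp_space p \<and> (\<forall>x\<in>U. \<exists>r>0. \<forall>y\<in>lp_space p. lp_norm p (\<lambda>n. x n - y n) < r \<longrightarrow> y \<in> U)"
proof -
  interpret Metric_space "lp_space p" "lp_dist p" by (rule Metric_space_lp[OF assms])
  show ?thesis
    unfolding lp_topology_def openin_mtopology by (fastforce simp: subset_eq lp_dist_def)
qed

lemma weighted_shift_basis_vec:
  "weighted_shift w (basis_vec 1) = (\<lambda>n. 0)"
  "2 \<le> n \<Longrightarrow> weighted_shift w (basis_vec n) = (\<lambda>i. w n * basis_vec (n - 1) i)"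
  by (auto simp: weighted_shift_def basis_vec_def fun_eq_iff)

lemma weighted_shift_linear:
  "weighted_shift w (\<lambda>n. a * x n + b * y n) =
     (\<lambda>n. a * weighted_shift w x n + b * weighted_shift w y n)"
  by (auto simp: weighted_shift_def fun_eq_iff algebra_simps)

lemma weighted_shift_bounded:
  assumes p: "1 \<le> p" and x: "x \<in> lp_space p" and C: "\<And>n. 1 \<le> n \<Longrightarrow> norm (w n) \<le> C"
  shows "weighted_shift w x \<in> lp_space p" "lp_norm p (weighted_shift w x) \<le> C * lp_norm p x"
proof -
  have C0: "0 \<le> C" using C[of 1] norm_ge_zero[of "w 1"] by linarith
  have sx: "(\<lambda>n. norm (x n) powr p) summable_on {1..}" using x by (simp add: lp_space_def)
  have sx2: "(\<lambda>n. norm (x n) powr p) summable_on {2..}"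
    by (rule summable_on_subset_banach[OF sx]) auto
  have Suc: "Suc ` {1..} = {2..}" by (auto simp: image_iff Suc_le_D numeral_2_eq_2 dest: Suc_le_D)
  have sS: "(\<lambda>n. norm (x (Suc n)) powr p) summable_on {1..}"
    using summable_on_reindex[of Suc "{1..}" "\<lambda>n. norm (x n) powr p"] sx2 Suc by (simp add: o_def)
  have iS: "(\<Sum>\<^sub>\<infinity>n\<in>{1..}. norm (x (Suc n)) powr p) = (\<Sum>\<^sub>\<infinity>n\<in>{2..}. norm (x n) powr p)"
    using infsum_reindex[of Suc "{1..}" "\<lambda>n. norm (x n) powr p"] Suc by (simp add: o_def)
  have le: "norm (weighted_shift w x n) powr p \<le> C powr p * norm (x (Suc n)) powr p" for n
  proof -
    have "norm (weighted_shift w x n) \<le> C * norm (x (Suc n))"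
      using C[of "Suc n"] C0 by (auto simp: weighted_shift_def norm_mult intro: mult_right_mono)
    then have "norm (weighted_shift w x n) powr p \<le> (C * norm (x (Suc n))) powr p"
      using p by (intro powr_mono2) auto
    then show ?thesis using C0 by (simp add: powr_mult)
  qed
  have sC: "(\<lambda>n. C powr p * norm (x (Suc n)) powr p) summable_on {1..}"
    by (rule summable_on_cmult_right[OF sS])
  have sB: "(\<lambda>n. norm (weighted_shift w x n) powr p) summable_on {1..}"
    by (rule summable_on_comparison_test[OF sC]) (use le in auto)
  show "weighted_shift w x \<in> lp_space p"
    using sB by (simp add: lp_space_def weighted_shift_def)
  have "(\<Sum>\<^sub>\<infinity>n\<in>{1..}. norm (weighted_shift w x n) powr p)
      \<le> (\<Sum>\<^sub>\<infinity>n\<in>{1..}. C powr p * norm (x (Suc n)) powr p)"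
    by (rule infsum_mono[OF sB sC le])
  also have "\<dots> = C powr p * (\<Sum>\<^sub>\<infinity>n\<in>{2..}. norm (x n) powr p)"
    using iS sS by (simp add: infsum_cmult_right)
  also have "\<dots> \<le> C powr p * (\<Sum>\<^sub>\<infinity>n\<in>{1..}. norm (x n) powr p)"
    by (intro mult_left_mono infsum_mono_neutral sx sx2) auto
  also have "\<dots> = (C * lp_norm p x) powr p"
    using C0 p by (simp add: powr_mult lp_norm_nonneg lp_norm_powr)
  finally have "lp_norm p (weighted_shift w x) \<le> ((C * lp_norm p x) powr p) powr (1 / p)"
    unfolding lp_norm_def[of p "weighted_shift w x"] using p
    by (intro powr_mono2 infsum_nonneg) auto
  also have "\<dots> = C * lp_norm p x" using C0 p by (simp add: powr_powr lp_norm_nonneg)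
  finally show "lp_norm p (weighted_shift w x) \<le> C * lp_norm p x" .
qed

end

theory Submission
  imports Defs "HOL-Real_Asymp.Real_Asymp" "HOL-Library.Discrete_Functions"
begin

text \<open>
  Let \<open>V\<^sub>n\<close> and \<open>W\<^sub>n\<close> denote the products of the weights of two shifts. Then \<open>B\<^sub>v\<^sup>n x\<close> has the
  coordinates \<open>(V\<^sub>l\<^sub>+\<^sub>n / V\<^sub>l) x\<^sub>l\<^sub>+\<^sub>n\<close>, and coordinate \<open>l\<close> of \<open>B\<^sub>w\<^sup>n x\<close> is that of \<open>B\<^sub>v\<^sup>n x\<close> times
  \<open>R\<^sub>l\<^sub>+\<^sub>n / R\<^sub>l\<close> with \<open>R = W / V\<close>. So the joint behaviour of the two orbits is governed by the ratio
  \<open>R\<close>: if both orbits are near given vectors at time \<open>n\<close>, then \<open>R\<close> has to follow a prescribed finite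
  pattern just after \<open>n\<close>.

  The weights are chosen so that \<open>R = 1\<close> outside the blocks \<open>[2\<^sup>k, 2\<^sup>k + k)\<close>. These have density zero, and
  outside them the two orbits share their first coordinate; hence the shifts are not disjoint upper
  frequently hypercyclic (\<open>not_disjoint_upper_freq_hypercyclic_product_shifts\<close>). The blocks are
  nevertheless arbitrarily long. Each of countably many patterns is repeated periodically in infinitely
  many of them, with a period that depends on the pattern only, and this allows return sets of positive upper
  Banach density (\<open>disjoint_reiteratively_hypercyclic_product_shifts\<close>). To let \<open>R\<close> follow an arbitrary
  pattern with bounded weights, both products are first raised by doubling; within the pattern they may
  then decrease, and a decrease of a product costs nothing (\<open>exists_admissible_realising\<close>).

  Throughout, \<open>\<bar>V\<^sub>n\<bar>\<close> and \<open>\<bar>W\<^sub>n\<bar>\<close> are at least \<open>n\<^sup>2\<close>. A vector \<open>y\<close> of finite support is then met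
  along an arithmetic progression of times by the orbit of a vector that contains rescaled copies of \<open>y\<close>
  (\<open>returning_vector_returns\<close>), and such copies can be added far out to any vector at a small cost
  (\<open>returning_vector_close\<close>). Since \<open>\<ell>\<^sup>p\<close> is complete, the Baire category theorem combines
  these finitely many returns for all targets into a single vector (\<open>Baire_return_times\<close>). The same
  mechanism, applied to one product at a time, shows that each shift is upper frequently hypercyclic.
\<close>

section \<open>The Banach space of p-summable sequences\<close>

lemma topspace_lp_topology:
  assumes "1 \<le> p"
  shows "topspace (lp_topology p) = (lp_space p :: (nat \<Rightarrow> 'a::real_normed_field) set)"
proof -
  interpret Metric_space "lp_space p :: (nat \<Rightarrow> 'a) set" "lp_dist p"
    by (rule Metric_space_lp[OF assms])
  show ?thesis by (simp add: lp_topology_def)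
qed

lemma zero_in_lp_space: "(\<lambda>n. 0) \<in> lp_space p"
  by (simp add: lp_space_def)

lemma coordinate_le_lp_norm:
  assumes p: "1 \<le> p" and x: "x \<in> lp_space p"
  shows "norm (x l) \<le> lp_norm p x"
proof (cases "l = 0")
  case False
  have s: "(\<lambda>n. norm (x n) powr p) summable_on {1..}" using x by (simp add: lp_space_def)
  have "(\<Sum>n\<in>{l}. norm (x n) powr p) \<le> (\<Sum>\<^sub>\<infinity>n\<in>{1..}. norm (x n) powr p)"
    using False by (intro finite_sum_le_infsum s) auto
  then have "norm (x l) powr p \<le> lp_norm p x powr p"
    by (simp add: lp_norm_powr[OF p])
  then show ?thesis
    using p powr_less_mono2[of p "lp_norm p x" "norm (x l)"] lp_norm_nonneg[of p x] by fastforce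
qed (use x in \<open>simp add: lp_space_def lp_norm_nonneg\<close>)

lemma lp_norm_le_of_finite_sums:
  assumes p: "1 \<le> p" and c: "0 \<le> c" and x0: "x 0 = 0"
    and F: "\<And>F. finite F \<Longrightarrow> F \<subseteq> {1..} \<Longrightarrow> (\<Sum>n\<in>F. norm (x n) powr p) \<le> c powr p"
  shows "x \<in> lp_space p" "lp_norm p x \<le> c"
proof -
  have s: "(\<lambda>n. norm (x n) powr p) summable_on {1..}"
    by (rule nonneg_bounded_partial_sums_imp_summable_on[where C = "c powr p"])
      (auto intro!: F eventually_finite_subsets_at_top_weakI)
  then show "x \<in> lp_space p" using x0 by (simp add: lp_space_def)
  have "(\<Sum>\<^sub>\<infinity>n\<in>{1..}. norm (x n) powr p) \<le> c powr p"
    by (rule infsum_le_finite_sums[OF s F])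
  then have "lp_norm p x \<le> (c powr p) powr (1 / p)"
    unfolding lp_norm_def using p by (intro powr_mono2 infsum_nonneg) auto
  then show "lp_norm p x \<le> c" using p c by (simp add: powr_powr)
qed

lemma finite_sum_le_lp_norm:
  assumes p: "1 \<le> p" and x: "x \<in> lp_space p" and F: "finite F" "F \<subseteq> {1..}"
  shows "(\<Sum>n\<in>F. norm (x n) powr p) \<le> lp_norm p x powr p"
proof -
  have "(\<Sum>n\<in>F. norm (x n) powr p) \<le> (\<Sum>\<^sub>\<infinity>n\<in>{1..}. norm (x n) powr p)"
    using x F by (intro finite_sum_le_infsum) (auto simp: lp_space_def)
  then show ?thesis by (simp add: lp_norm_powr[OF p])
qed

lemma lp_norm_tail_small:
  assumes p: "1 \<le> p" and x: "x \<in> lp_space p" and e: "0 < e"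
  shows "\<exists>a0. \<forall>a\<ge>a0. lp_norm p (\<lambda>l. if l \<le> a then 0 else x l) < e"
proof -
  have s: "(\<lambda>n. norm (x n) powr p) summable_on {1..}" using x by (simp add: lp_space_def)
  define S where "S = (\<Sum>\<^sub>\<infinity>n\<in>{1..}. norm (x n) powr p)"
  define r where "r = (e / 2) powr p"
  have "0 < r" using e by (simp add: r_def)
  obtain F where F: "finite F" "F \<subseteq> {1..}" "dist (\<Sum>n\<in>F. norm (x n) powr p) S \<le> r"
    unfolding S_def using infsum_finite_approximation[OF s \<open>0 < r\<close>] by blast
  obtain a0 where a0: "\<And>l. l \<in> F \<Longrightarrow> l \<le> a0"
    using F(1) by (meson finite_nat_set_iff_bounded_le)
  have "lp_norm p (\<lambda>l. if l \<le> a then 0 else x l) < e" if "a0 \<le> a" for a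
  proof -
    have "lp_norm p (\<lambda>l. if l \<le> a then 0 else x l) \<le> e / 2"
    proof (rule lp_norm_le_of_finite_sums(2)[OF p])
      fix G :: "nat set" assume G: "finite G" "G \<subseteq> {1..}"
      have "(\<Sum>n\<in>G. norm (if n \<le> a then 0 else x n) powr p)
          = (\<Sum>n\<in>G. if n \<le> a then 0 else norm (x n) powr p)"
        by (intro sum.cong) auto
      also have "\<dots> = (\<Sum>n\<in>G - {..a}. norm (x n) powr p)"
        using G(1) by (intro sum.mono_neutral_cong_right) auto
      also have "\<dots> + (\<Sum>n\<in>F. norm (x n) powr p) = (\<Sum>n\<in>(G - {..a}) \<union> F. norm (x n) powr p)"
        using G(1) F(1) a0 that by (intro sum.union_disjoint[symmetric]) force+
      also have "\<dots> \<le> S"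
        unfolding S_def using G F by (intro finite_sum_le_infsum s) auto
      finally show "(\<Sum>n\<in>G. norm (if n \<le> a then 0 else x n) powr p) \<le> (e / 2) powr p"
        using F(3) by (simp add: dist_real_def r_def)
    qed (use e in auto)
    then show ?thesis using e by simp
  qed
  then show ?thesis by blast
qed

text \<open>
  A Cauchy sequence converges in every coordinate; bounds on finite partial sums of the norms pass to
  the coordinatewise limit.
\<close>

lemma completely_metrizable_lp_topology:
  assumes p: "1 \<le> p"
  shows "completely_metrizable_space (lp_topology p :: (nat \<Rightarrow> 'a::{real_normed_field, banach}) topology)"
proof -
  interpret Metric_space "lp_space p :: (nat \<Rightarrow> 'a) set" "lp_dist p"
    by (rule Metric_space_lp[OF p])
  have "mcomplete"
    unfolding mcomplete_def
  proof (intro allI impI)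
    fix s :: "nat \<Rightarrow> nat \<Rightarrow> 'a" assume s: "MCauchy s"
    then have sin: "s n \<in> lp_space p" for n by (auto simp: MCauchy_def)
    have sC: "\<exists>N. \<forall>m\<ge>N. \<forall>n\<ge>N. lp_norm p (\<lambda>l. s m l - s n l) < e" if "0 < e" for e
      using s that unfolding MCauchy_def lp_dist_def by meson
    have "Cauchy (\<lambda>n. s n l)" for l
    proof (rule metric_CauchyI)
      fix e :: real assume "0 < e"
      from sC[OF this] obtain N
        where N: "\<And>m n. m \<ge> N \<Longrightarrow> n \<ge> N \<Longrightarrow> lp_norm p (\<lambda>l. s m l - s n l) < e" by blast
      have "dist (s m l) (s n l) < e" if "m \<ge> N" "n \<ge> N" for m n
        using coordinate_le_lp_norm[OF p lp_space_diff[OF p sin[of m] sin[of n]], of l] N[OF that]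
        by (simp add: dist_norm)
      then show "\<exists>M. \<forall>m\<ge>M. \<forall>n\<ge>M. dist (s m l) (s n l) < e" by blast
    qed
    then have "\<exists>x. \<forall>l. (\<lambda>n. s n l) \<longlonglongrightarrow> x l"
      by (intro choice allI) (simp add: Cauchy_convergent_iff convergent_def)
    then obtain x where x: "\<And>l. (\<lambda>n. s n l) \<longlonglongrightarrow> x l" by blast
    have x0: "x 0 = 0"
      using x[of 0] sin by (simp add: lp_space_def LIMSEQ_const_iff)
    have close: "\<exists>N. \<forall>n\<ge>N. (\<lambda>l. s n l - x l) \<in> lp_space p \<and> lp_norm p (\<lambda>l. s n l - x l) < e"
      if e: "0 < e" for e
    proof -
      obtain N where N: "\<And>m n. m \<ge> N \<Longrightarrow> n \<ge> N \<Longrightarrow> lp_norm p (\<lambda>l. s m l - s n l) < e / 2"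
        using sC[of "e / 2"] e by auto
      have "(\<lambda>l. s n l - x l) \<in> lp_space p \<and> lp_norm p (\<lambda>l. s n l - x l) \<le> e / 2" if n: "n \<ge> N" for n
      proof -
        have le: "(\<Sum>l\<in>F. norm (s n l - x l) powr p) \<le> (e / 2) powr p"
          if F: "finite F" "F \<subseteq> {1..}" for F
        proof -
        have lim: "(\<lambda>m. \<Sum>l\<in>F. norm (s n l - s m l) powr p) \<longlonglongrightarrow> (\<Sum>l\<in>F. norm (s n l - x l) powr p)"
          using p by (intro tendsto_intros x) auto
        have "(\<Sum>l\<in>F. norm (s n l - s m l) powr p) \<le> (e / 2) powr p" if m: "m \<ge> N" for m
        proof -
          have "(\<Sum>l\<in>F. norm (s n l - s m l) powr p) \<le> lp_norm p (\<lambda>l. s n l - s m l) powr p"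
            by (rule finite_sum_le_lp_norm[OF p lp_space_diff[OF p sin sin] F])
          also have "\<dots> \<le> (e / 2) powr p"
            using N[OF n m] p by (intro powr_mono2) (auto simp: lp_norm_nonneg)
          finally show ?thesis .
        qed
        then show ?thesis
          by (intro LIMSEQ_le_const2[OF lim]) blast
        qed
        have "s n 0 - x 0 = 0" using x0 sin by (simp add: lp_space_def)
        from lp_norm_le_of_finite_sums[OF p _ this le] show ?thesis using e by simp
      qed
      then show ?thesis using e by (intro exI[of _ N]) force
    qed
    obtain N where "(\<lambda>l. s N l - x l) \<in> lp_space p" using close[of 1] by auto
    from lp_space_diff[OF p sin[of N] this] have "x \<in> lp_space p" by simp
    then have "limitin mtopology s x sequentially"
      using close sin by (fastforce simp: limit_metric_sequentially lp_dist_def)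
    then show "\<exists>x. limitin mtopology s x sequentially" by blast
  qed
  then show ?thesis
    unfolding lp_topology_def by (rule completely_metrizable_space_mtopology)
qed

lemma openin_lp_ball:
  assumes p: "1 \<le> p" and y: "y \<in> lp_space p"
  shows "openin (lp_topology p) {x \<in> lp_space p. lp_norm p (\<lambda>l. x l - y l) < r}"
  unfolding openin_lp_topology[OF p]
proof (intro conjI ballI)
  fix x assume "x \<in> {x \<in> lp_space p. lp_norm p (\<lambda>l. x l - y l) < r}"
  then have x: "x \<in> lp_space p" "lp_norm p (\<lambda>l. x l - y l) < r" by auto
  interpret Metric_space "lp_space p :: (nat \<Rightarrow> 'a) set" "lp_dist p"
    by (rule Metric_space_lp[OF p])
  have "lp_norm p (\<lambda>l. z l - y l) < r"
    if z: "z \<in> lp_space p" "lp_norm p (\<lambda>l. x l - z l) < r - lp_norm p (\<lambda>l. x l - y l)" for z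
    using triangle[OF z(1) x(1) y] z(2) commute[of x z] by (simp add: lp_dist_def)
  then show "\<exists>d>0. \<forall>z\<in>lp_space p. lp_norm p (\<lambda>n. x n - z n) < d \<longrightarrow>
      z \<in> {x \<in> lp_space p. lp_norm p (\<lambda>l. x l - y l) < r}"
    using x by (intro exI[of _ "r - lp_norm p (\<lambda>l. x l - y l)"]) auto
qed auto

text \<open>
  The products of weights constructed below satisfy \<open>\<bar>V n\<bar> \<ge> n\<^sup>2\<close>. All errors in the construction are
  therefore dominated coordinatewise by a multiple of this one sequence, which belongs to every
  \<open>\<ell>\<^sup>p\<close> with \<open>p \<ge> 1\<close>; no sum has to be estimated again.
\<close>

lemma inverse_square_in_lp_space:
  assumes p: "1 \<le> p"
  shows "(\<lambda>l. of_real (inverse (real l ^ 2)) :: 'a::real_normed_field) \<in> lp_space p"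
proof -
  have "(\<lambda>l. inverse (real l ^ 2)) summable_on UNIV"
    by (intro summable_nonneg_imp_summable_on inverse_power_summable) auto
  then have s: "(\<lambda>l. inverse (real l ^ 2)) summable_on {1..}"
    by (rule summable_on_subset_banach) auto
  have "(\<lambda>l. norm (of_real (inverse (real l ^ 2)) :: 'a) powr p) summable_on {1..}"
  proof (rule summable_on_comparison_test[OF s])
    fix l :: nat assume "l \<in> {1..}"
    then have "inverse (real l ^ 2) powr p \<le> inverse (real l ^ 2) powr 1"
      using p by (intro powr_mono') (auto simp: inverse_le_1_iff power_le_one_iff)
    then show "norm (of_real (inverse (real l ^ 2)) :: 'a) powr p \<le> inverse (real l ^ 2)"
      by (simp del: of_real_inverse)
  qed auto
  then show ?thesis by (simp add: lp_space_def)
qed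

lemma lp_norm_scale:
  assumes p: "1 \<le> p"
  shows "lp_norm p (\<lambda>n. c * x n) = norm c * lp_norm p x"
proof -
  have "lp_norm p (\<lambda>n. c * x n) = (norm c powr p * (\<Sum>\<^sub>\<infinity>n\<in>{1..}. norm (x n) powr p)) powr (1 / p)"
    by (simp add: lp_norm_def norm_mult powr_mult infsum_cmult_right')
  also have "\<dots> = norm c * lp_norm p x"
    using p by (simp add: powr_mult powr_powr lp_norm_def infsum_nonneg)
  finally show ?thesis .
qed

lemma finite_support_in_lp_space:
  assumes "x 0 = 0" "\<And>l. J < l \<Longrightarrow> x l = 0"
  shows "x \<in> lp_space p"
proof -
  have "(\<lambda>n. norm (x n) powr p) summable_on {1..} \<longleftrightarrow> (\<lambda>n. norm (x n) powr p) summable_on {1..J}"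
    using assms(2) by (intro summable_on_cong_neutral) auto
  then show ?thesis using assms(1) by (simp add: lp_space_def)
qed

lemma inverse_square_decay_small:
  assumes p: "1 \<le> p" and C: "0 \<le> C" and r: "0 < r"
  shows "\<exists>m0. \<forall>m\<ge>m0. \<forall>x :: nat \<Rightarrow> 'a::real_normed_field.
    (\<forall>l\<le>m. x l = 0) \<and> (\<forall>l>m. norm (x l) \<le> C / real l ^ 2) \<longrightarrow> x \<in> lp_space p \<and> lp_norm p x < r"
proof -
  define h :: "nat \<Rightarrow> 'a" where "h l = of_real (inverse (real l ^ 2))" for l
  have h: "h \<in> lp_space p" unfolding h_def by (rule inverse_square_in_lp_space[OF p])
  have "0 < r / (C + 1)" using C r by simp
  from lp_norm_tail_small[OF p h this] obtain m0
    where m0: "\<And>m. m0 \<le> m \<Longrightarrow> lp_norm p (\<lambda>l. if l \<le> m then 0 else h l) < r / (C + 1)" by blast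
  have "x \<in> lp_space p \<and> lp_norm p x < r"
    if m: "m0 \<le> m" and x: "\<forall>l\<le>m. x l = 0" "\<forall>l>m. norm (x l) \<le> C / real l ^ 2" for m and x :: "nat \<Rightarrow> 'a"
  proof -
    define t where "t l = (if l \<le> m then 0 else h l)" for l
    have t: "t \<in> lp_space p" by (rule lp_dominated(1)[OF p h]) (auto simp: t_def)
    have "lp_norm p (\<lambda>l. of_real C * t l) = C * lp_norm p t" using C by (simp add: lp_norm_scale[OF p])
    also have "\<dots> \<le> C * (r / (C + 1))"
      using m0[OF m] C by (intro mult_left_mono) (auto simp: t_def[abs_def])
    also have "\<dots> < r" using C r by (simp add: field_simps)
    finally have less: "lp_norm p (\<lambda>l. of_real C * t l) < r" .
    have dom: "norm (x l) \<le> norm (of_real C * t l)" for l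
      using x C by (cases "l \<le> m") (auto simp: t_def h_def norm_mult norm_inverse norm_power divide_inverse)
    have ct: "(\<lambda>l. of_real C * t l) \<in> lp_space p"
      using t by (auto simp: lp_space_def norm_mult powr_mult intro: summable_on_cmult_right)
    show ?thesis
      using lp_dominated[OF p ct _ dom] x(1) less by force
  qed
  then show ?thesis by blast
qed

lemma lp_close_if_tail_decays:
  fixes u :: "nat \<Rightarrow> 'a::real_normed_field"
  assumes p: "1 \<le> p" and C: "0 \<le> C" and r: "0 < r" and u: "u \<in> lp_space p"
  shows "\<exists>m0. \<forall>m\<ge>m0. \<forall>x. (\<forall>l\<le>m. x l = u l) \<and> (\<forall>l>m. norm (x l) \<le> C / real l ^ 2)
      \<longrightarrow> x \<in> lp_space p \<and> lp_norm p (\<lambda>l. u l - x l) < r"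
proof -
  have r2: "0 < r / 2" using r by simp
  obtain m1 where m1: "\<And>m. m1 \<le> m \<Longrightarrow> lp_norm p (\<lambda>l. if l \<le> m then 0 else u l) < r / 2"
    using lp_norm_tail_small[OF p u r2] by blast
  obtain m2 where m2: "\<And>m (x :: nat \<Rightarrow> 'a). m2 \<le> m \<Longrightarrow> \<forall>l\<le>m. x l = 0 \<Longrightarrow>
      \<forall>l>m. norm (x l) \<le> C / real l ^ 2 \<Longrightarrow> x \<in> lp_space p \<and> lp_norm p x < r / 2"
    using inverse_square_decay_small[OF p C r2] by blast
  have "x \<in> lp_space p \<and> lp_norm p (\<lambda>l. u l - x l) < r"
    if m: "max m1 m2 \<le> m" and x: "\<forall>l\<le>m. x l = u l" "\<forall>l>m. norm (x l) \<le> C / real l ^ 2" for m x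
  proof -
    define t s where "t l = (if l \<le> m then 0 else u l)" and "s l = (if l \<le> m then 0 else x l)" for l
    have t: "t \<in> lp_space p" by (rule lp_dominated(1)[OF p u]) (auto simp: t_def)
    have tn: "lp_norm p t < r / 2" using m1 m by (simp add: t_def[abs_def])
    have s: "s \<in> lp_space p \<and> lp_norm p s < r / 2"
      by (rule m2[of m]) (use m x in \<open>auto simp: s_def\<close>)
    have ts: "u l - x l = t l - s l" for l using x by (simp add: t_def s_def)
    have "norm (u l - x l) \<le> norm (t l) + norm (s l)" for l
      unfolding ts by (rule norm_triangle_ineq4)
    moreover have "u 0 - x 0 = 0" using x by simp
    ultimately have d: "(\<lambda>l. u l - x l) \<in> lp_space p \<and> lp_norm p (\<lambda>l. u l - x l) \<le> lp_norm p t + lp_norm p s"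
      using Minkowski[OF p t, of s "\<lambda>l. u l - x l"] s by blast
    have "(\<lambda>l. u l - (u l - x l)) \<in> lp_space p" by (rule lp_space_diff[OF p u d[THEN conjunct1]])
    then show ?thesis using d s tn by simp
  qed
  then show ?thesis by blast
qed

lemma lp_close_if_coordinates_close:
  fixes y :: "nat \<Rightarrow> 'a::real_normed_field"
  assumes p: "1 \<le> p" and e: "0 < e" and y: "y \<in> lp_space p"
  shows "\<exists>J0 \<eta>. 0 < \<eta> \<and> (\<forall>J\<ge>J0. \<forall>z. z 0 = 0 \<and> (\<forall>l\<in>{1..J}. norm (y l - z l) \<le> \<eta> / real l ^ 2)
      \<and> (\<forall>l>J. z l = 0) \<longrightarrow> lp_norm p (\<lambda>l. y l - z l) < e)"
proof -
  define h :: "nat \<Rightarrow> 'a" where "h l = of_real (inverse (real l ^ 2))" for l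
  have h: "h \<in> lp_space p" unfolding h_def by (rule inverse_square_in_lp_space[OF p])
  have e2: "0 < e / 2" using e by simp
  obtain J0 where J0: "\<And>J. J0 \<le> J \<Longrightarrow> lp_norm p (\<lambda>l. if l \<le> J then 0 else y l) < e / 2"
    using lp_norm_tail_small[OF p y e2] by blast
  define N where "N = lp_norm p h + 1"
  have N: "0 < N" "lp_norm p h \<le> N" using lp_norm_nonneg[of p h] by (auto simp: N_def)
  define \<eta> where "\<eta> = e / 2 / N"
  have \<eta>: "0 < \<eta>" using e N by (simp add: \<eta>_def)
  have "lp_norm p (\<lambda>l. y l - z l) < e"
    if J: "J0 \<le> J" and z: "z 0 = 0" "\<forall>l\<in>{1..J}. norm (y l - z l) \<le> \<eta> / real l ^ 2" "\<forall>l>J. z l = 0" for J z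
  proof -
    define t s where "t l = (if l \<le> J then 0 else y l)" and "s l = of_real \<eta> * h l" for l
    have t: "t \<in> lp_space p" by (rule lp_dominated(1)[OF p y]) (auto simp: t_def)
    have tn: "lp_norm p t < e / 2" using J0[OF J] by (simp add: t_def[abs_def])
    have s: "s \<in> lp_space p"
      using h by (auto simp: s_def lp_space_def norm_mult powr_mult intro: summable_on_cmult_right)
    have "lp_norm p s = \<eta> * lp_norm p h" using \<eta> by (simp add: s_def[abs_def] lp_norm_scale[OF p])
    also have "\<dots> \<le> \<eta> * N" using \<eta> N by simp
    also have "\<dots> = e / 2" using N by (simp add: \<eta>_def)
    finally have sn: "lp_norm p s \<le> e / 2" .
    have yz0: "y 0 - z 0 = 0" using y z(1) by (simp add: lp_space_def)
    have "norm (y l - z l) \<le> norm (t l) + norm (s l)" for l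
    proof (cases "l = 0 \<or> J < l")
      case True
      then show ?thesis using yz0 z(3) by (cases "l = 0") (auto simp: t_def)
    next
      case False
      then have "norm (y l - z l) \<le> \<eta> / real l ^ 2" using z(2) by auto
      also have "\<dots> = norm (s l)"
        using \<eta> by (simp add: s_def h_def norm_mult norm_inverse norm_power divide_inverse)
      finally show ?thesis by (simp add: add_increasing)
    qed
    then have "lp_norm p (\<lambda>l. y l - z l) \<le> lp_norm p t + lp_norm p s"
      using Minkowski[OF p t s, of "\<lambda>l. y l - z l"] yz0 by blast
    then show ?thesis using sn tn by linarith
  qed
  then show ?thesis using \<eta> by blast
qed

section \<open>Positive density and Baire category\<close>

lemma limsup_pos_if_often_ge:
  assumes "0 < \<delta>" "\<And>m. \<exists>M\<ge>m. ereal \<delta> \<le> f M"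
  shows "0 < limsup f"
proof -
  have "ereal \<delta> \<le> limsup f"
    unfolding limsup_INF_SUP
  proof (rule INF_greatest)
    fix m
    obtain M where "M \<ge> m" "ereal \<delta> \<le> f M" using assms(2) by blast
    then show "ereal \<delta> \<le> (SUP k\<in>{m..}. f k)" by (intro SUP_upper2[of M]) auto
  qed
  moreover have "0 < ereal \<delta>" using assms(1) by simp
  ultimately show ?thesis by (rule order.strict_trans2[rotated])
qed

lemma upper_density_mono:
  assumes "A \<subseteq> B"
  shows "upper_density A \<le> upper_density B"
  unfolding upper_density_def
proof (intro Limsup_mono always_eventually allI)
  fix M
  have "card (A \<inter> {1..M}) \<le> card (B \<inter> {1..M})" using assms by (intro card_mono) auto
  then show "ereal (real (card (A \<inter> {1..M})) / real M) \<le> ereal (real (card (B \<inter> {1..M})) / real M)"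
    by (simp add: divide_right_mono)
qed

text \<open>
  Both upper densities of a return set are positive as soon as arbitrarily long windows contain a fixed
  proportion \<open>\<delta>\<close> of return times. The following families collect the possible sets of return times
  inside one window of length at least \<open>m\<close>; \<open>initial_windows\<close> belongs to the upper density and
  \<open>shifted_windows\<close> to the upper Banach density. Their members are finite, so asking that an orbit return
  at all times of one member is an open condition on its starting point.
\<close>

definition initial_windows :: "real \<Rightarrow> nat \<Rightarrow> nat set set" where
  "initial_windows \<delta> m = {S. \<exists>M\<ge>m. S \<subseteq> {1..M} \<and> \<delta> * real M \<le> real (card S)}"

definition shifted_windows :: "real \<Rightarrow> nat \<Rightarrow> nat set set" where
  "shifted_windows \<delta> m = {S. \<exists>M\<ge>m. \<exists>k\<ge>1. S \<subseteq> {k + 1..k + M} \<and> \<delta> * real M \<le> real (card S)}"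

lemma finite_initial_windows: "S \<in> initial_windows \<delta> m \<Longrightarrow> finite S"
  by (auto simp: initial_windows_def intro: finite_subset)

lemma finite_shifted_windows: "S \<in> shifted_windows \<delta> m \<Longrightarrow> finite S"
  by (auto simp: shifted_windows_def intro: finite_subset)

lemma upper_density_pos:
  assumes \<delta>: "0 < \<delta>" and S: "\<And>m. \<exists>S\<in>initial_windows \<delta> m. S \<subseteq> A"
  shows "0 < upper_density A"
  unfolding upper_density_def
proof (rule limsup_pos_if_often_ge[OF \<delta>])
  fix m
  obtain M S where M: "M \<ge> Suc m" "S \<subseteq> {1..M}" "\<delta> * real M \<le> real (card S)" "S \<subseteq> A"
    using S[of "Suc m"] by (auto simp: initial_windows_def)
  then have "card S \<le> card (A \<inter> {1..M})" by (intro card_mono) auto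
  then have "\<delta> * real M \<le> real (card (A \<inter> {1..M}))" using M(3) by linarith
  then have "\<delta> \<le> real (card (A \<inter> {1..M})) / real M" using M(1) by (simp add: field_simps)
  then show "\<exists>M\<ge>m. ereal \<delta> \<le> ereal (real (card (A \<inter> {1..M})) / real M)"
    using M(1) by (intro exI[of _ M]) auto
qed

lemma upper_Banach_density_pos:
  assumes \<delta>: "0 < \<delta>" and S: "\<And>m. \<exists>S\<in>shifted_windows \<delta> m. S \<subseteq> A"
  shows "0 < upper_Banach_density A"
  unfolding upper_Banach_density_def
proof (rule limsup_pos_if_often_ge[OF \<delta>])
  fix m
  obtain M k S where M: "M \<ge> Suc m" "k \<ge> 1" "S \<subseteq> {k + 1..k + M}" "\<delta> * real M \<le> real (card S)" "S \<subseteq> A"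
    using S[of "Suc m"] by (auto simp: shifted_windows_def)
  have "card S \<le> card (A \<inter> {k + 1..k + M})" using M by (intro card_mono) auto
  also have "\<dots> \<le> (MAX k\<in>{1..}. card (A \<inter> {k + 1..k + M}))"
    using M(2) by (intro Max_ge finite_window_counts) auto
  finally have "\<delta> * real M \<le> real (MAX k\<in>{1..}. card (A \<inter> {k + 1..k + M}))" using M(4) by linarith
  then have "\<delta> \<le> real (MAX k\<in>{1..}. card (A \<inter> {k + 1..k + M})) / real M"
    using M(1) by (simp add: field_simps)
  then show "\<exists>M\<ge>m. ereal \<delta> \<le> ereal (real (MAX k\<in>{1..}. card (A \<inter> {k + 1..k + M})) / real M)"
    using M(1) by (intro exI[of _ M]) auto
qed

text \<open>
  For one target \<open>i\<close> and one \<open>m\<close>, the points that return at all times of some member of \<open>\<W> \<delta> m\<close>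
  form an open set, and by \<open>dense\<close> this set is dense. There are countably many such sets, so a common
  point exists. The proportion \<open>\<delta>\<close> must depend on the target only, not on the open set \<open>U\<close>.
\<close>

lemma Baire_return_times:
  fixes X :: "'x topology" and P :: "'i \<Rightarrow> nat \<Rightarrow> 'x set" and \<W> :: "real \<Rightarrow> nat \<Rightarrow> nat set set"
  assumes X: "completely_metrizable_space X" "topspace X \<noteq> {}" and I: "countable I"
    and opn: "\<And>i n. i \<in> I \<Longrightarrow> openin X (P i n)"
    and fin: "\<And>\<delta> m S. S \<in> \<W> \<delta> m \<Longrightarrow> finite S"
    and dense: "\<And>i. i \<in> I \<Longrightarrow> \<exists>\<delta>>0. \<forall>U m. openin X U \<and> U \<noteq> {} \<longrightarrow>
      (\<exists>S\<in>\<W> \<delta> m. \<exists>x\<in>U. \<forall>n\<in>S. x \<in> P i n)"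
  shows "\<exists>x\<in>topspace X. \<forall>i\<in>I. \<exists>\<delta>>0. \<forall>m. \<exists>S\<in>\<W> \<delta> m. \<forall>n\<in>S. x \<in> P i n"
proof -
  obtain \<delta> where \<delta>: "\<And>i. i \<in> I \<Longrightarrow> 0 < \<delta> i" "\<And>i U m. i \<in> I \<Longrightarrow> openin X U \<Longrightarrow> U \<noteq> {} \<Longrightarrow>
      \<exists>S\<in>\<W> (\<delta> i) m. \<exists>x\<in>U. \<forall>n\<in>S. x \<in> P i n"
    using dense by metis
  define G where "G i m = (\<Union>S\<in>\<W> (\<delta> i) m. topspace X \<inter> (\<Inter>n\<in>S. P i n))" for i m
  have "openin X (G i m) \<and> X closure_of G i m = topspace X" if i: "i \<in> I" for i m
  proof
    have "openin X (topspace X \<inter> (\<Inter>n\<in>S. P i n))" if "S \<in> \<W> (\<delta> i) m" for S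
      using fin[OF that] opn[OF i] by (cases "S = {}") (auto intro!: openin_Inter)
    then show "openin X (G i m)" unfolding G_def by (intro openin_Union) blast
    have "G i m \<inter> U \<noteq> {}" if U: "openin X U" "U \<noteq> {}" for U
    proof -
      obtain S x where "S \<in> \<W> (\<delta> i) m" "x \<in> U" "\<forall>n\<in>S. x \<in> P i n" using \<delta>(2)[OF i U] by blast
      then have "x \<in> G i m \<inter> U" using openin_subset[OF U(1)] by (auto simp: G_def)
      then show ?thesis by blast
    qed
    then show "X closure_of G i m = topspace X"
      by (auto simp: dense_intersects_open)
  qed
  then have "X closure_of \<Inter>((\<lambda>(i, m). G i m) ` (I \<times> UNIV)) = topspace X"
    using X(1) I by (intro Baire_category) auto
  then have "topspace X \<inter> \<Inter>((\<lambda>(i, m). G i m) ` (I \<times> UNIV)) \<noteq> {}"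
    using X(2) by (metis closure_of_empty closure_of_restrict)
  then obtain x where x: "x \<in> topspace X" "\<And>i m. i \<in> I \<Longrightarrow> x \<in> G i m" by blast
  have "\<exists>S\<in>\<W> (\<delta> i) m. \<forall>n\<in>S. x \<in> P i n" if "i \<in> I" for i m
    using x(2)[OF that, of m] by (auto simp: G_def)
  then show ?thesis using x(1) \<delta>(1) by blast
qed

section \<open>Shifts given by the products of their weights\<close>

text \<open>
  A weighted shift is described by the products of its weights instead of the weights themselves:
  \<open>w\<^sub>2 \<cdots> w\<^sub>n = V\<^sub>n / V\<^sub>1\<close>. The iterates then have the closed form of
  \<open>funpow_product_shift\<close> below, and boundedness and growth are read off from \<open>V\<close>.
\<close>

definition product_weights :: "(nat \<Rightarrow> 'a::real_normed_field) \<Rightarrow> nat \<Rightarrow> 'a" where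
  "product_weights V n = (if n \<le> 1 then 1 else V n / V (n - 1))"

abbreviation product_shift :: "(nat \<Rightarrow> 'a::real_normed_field) \<Rightarrow> (nat \<Rightarrow> 'a) \<Rightarrow> nat \<Rightarrow> 'a" where
  "product_shift V \<equiv> weighted_shift (product_weights V)"

lemma funpow_weighted_shift_in_lp_space:
  assumes p: "1 \<le> p" and C: "\<And>n. 1 \<le> n \<Longrightarrow> norm (w n) \<le> C" and x: "x \<in> lp_space p"
  shows "(weighted_shift w ^^ n) x \<in> lp_space p"
proof (induction n)
  case (Suc n)
  then show ?case using weighted_shift_bounded(1)[OF p _ C] by simp
qed (use x in simp)

lemma openin_vimage_weighted_shift:
  assumes p: "1 \<le> p" and C: "\<And>n. 1 \<le> n \<Longrightarrow> norm (w n) \<le> C" and U: "openin (lp_topology p) U"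
  shows "openin (lp_topology p) {x \<in> lp_space p. weighted_shift w x \<in> U}"
  unfolding openin_lp_topology[OF p]
proof (intro conjI ballI)
  fix x assume "x \<in> {x \<in> lp_space p. weighted_shift w x \<in> U}"
  then have x: "x \<in> lp_space p" "weighted_shift w x \<in> U" by auto
  obtain r where r: "r > 0" "\<And>y. y \<in> lp_space p \<Longrightarrow> lp_norm p (\<lambda>n. weighted_shift w x n - y n) < r \<Longrightarrow> y \<in> U"
    using U x(2) unfolding openin_lp_topology[OF p] by blast
  have C0: "0 \<le> C" using C[of 1] norm_ge_zero[of "w 1"] by linarith
  have "weighted_shift w y \<in> U" if y: "y \<in> lp_space p" "lp_norm p (\<lambda>n. x n - y n) < r / (C + 1)" for y
  proof (rule r(2))
    show "weighted_shift w y \<in> lp_space p" by (rule weighted_shift_bounded(1)[OF p y(1) C])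
    have "(\<lambda>n. weighted_shift w x n - weighted_shift w y n) = weighted_shift w (\<lambda>n. x n - y n)"
      by (auto simp: weighted_shift_def algebra_simps)
    then have "lp_norm p (\<lambda>n. weighted_shift w x n - weighted_shift w y n) \<le> C * lp_norm p (\<lambda>n. x n - y n)"
      using weighted_shift_bounded(2)[OF p lp_space_diff[OF p x(1) y(1)] C] by simp
    also have "\<dots> \<le> C * (r / (C + 1))" using y(2) C0 by (intro mult_left_mono) auto
    also have "\<dots> < r" using C0 r(1) by (simp add: field_simps)
    finally show "lp_norm p (\<lambda>n. weighted_shift w x n - weighted_shift w y n) < r" .
  qed
  then show "\<exists>r>0. \<forall>y\<in>lp_space p. lp_norm p (\<lambda>n. x n - y n) < r
      \<longrightarrow> y \<in> {x \<in> lp_space p. weighted_shift w x \<in> U}"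
    using r(1) C0 by (intro exI[of _ "r / (C + 1)"]) auto
qed auto

lemma openin_vimage_funpow_weighted_shift:
  assumes p: "1 \<le> p" and C: "\<And>n. 1 \<le> n \<Longrightarrow> norm (w n) \<le> C" and U: "openin (lp_topology p) U"
  shows "openin (lp_topology p) {x \<in> lp_space p. (weighted_shift w ^^ n) x \<in> U}"
proof (induction n)
  case 0
  have "{x \<in> lp_space p. x \<in> U} = U"
    using openin_subset[OF U] topspace_lp_topology[OF p, where 'a='a] by blast
  then show ?case using U by simp
next
  case (Suc n)
  have "{x \<in> lp_space p. (weighted_shift w ^^ Suc n) x \<in> U}
      = {x \<in> lp_space p. weighted_shift w x \<in> {x \<in> lp_space p. (weighted_shift w ^^ n) x \<in> U}}"
    using weighted_shift_bounded(1)[OF p _ C] by (auto simp: funpow_Suc_right simp del: funpow.simps)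
  then show ?case using openin_vimage_weighted_shift[OF p C Suc] by simp
qed

text \<open>
  The growth bound makes the weights bounded. The quadratic lower bound makes
  \<open>\<Sum> 1 / \<bar>V n\<bar>\<^sup>p\<close> converge, the classical condition for \<open>B\<^sub>w\<close> to be chaotic on
  \<open>\<ell>\<^sup>p\<close> and frequently hypercyclic.
\<close>

locale shift_products =
  fixes p :: real and V :: "nat \<Rightarrow> 'a::{real_normed_field, banach, second_countable_topology}"
  assumes p: "1 \<le> p"
    and lower: "\<And>n. 1 \<le> n \<Longrightarrow> real n ^ 2 \<le> norm (V n)"
    and growth: "\<And>n. 1 \<le> n \<Longrightarrow> norm (V (Suc n)) \<le> 8 * norm (V n)"
begin

lemma nonzero: "1 \<le> n \<Longrightarrow> V n \<noteq> 0"
  using lower[of n] by auto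

lemma norm_weights_le: "norm (product_weights V n) \<le> 8"
proof (cases "n \<le> 1")
  case False
  then have n: "1 \<le> n - 1" "Suc (n - 1) = n" by auto
  have "0 < norm (V (n - 1))" using nonzero[OF n(1)] by simp
  then show ?thesis
    using growth[OF n(1)] False unfolding n(2) by (simp add: product_weights_def norm_divide divide_le_eq)
qed (simp add: product_weights_def)

lemma bounded_weights: "bounded (product_weights V ` {1..})"
  by (rule boundedI[of _ 8]) (auto simp: norm_weights_le)

lemmas funpow_in_lp_space = funpow_weighted_shift_in_lp_space[OF p norm_weights_le]

lemma funpow_product_shift:
  "1 \<le> l \<Longrightarrow> (product_shift V ^^ n) x l = V (l + n) / V l * x (l + n)"
proof (induction n arbitrary: l)
  case 0
  then show ?case using nonzero[of l] by simp
next
  case (Suc n)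
  have "(product_shift V ^^ Suc n) x l = V (Suc l) / V l * (product_shift V ^^ n) x (Suc l)"
    using Suc.prems by (simp add: weighted_shift_def product_weights_def)
  then show ?case using Suc.IH[of "Suc l"] nonzero[of "Suc l"] by simp
qed

text \<open>
  After the first \<open>a\<close> coordinates of \<open>u\<close> come \<open>T\<close> copies of \<open>y\<close>, spaced by \<open>P\<close> and divided by the
  factors that the shift will multiply them with. When the \<open>q\<close>-th copy has been moved to the front, the
  coordinates of \<open>u\<close> and the earlier copies are gone, and coordinate \<open>l\<close> of what remains is
  \<open>V\<^sub>j y\<^sub>j / V\<^sub>l\<close> with \<open>j = l mod P\<close>: exactly \<open>y\<^sub>l\<close> for \<open>l < P\<close>, and of order
  \<open>1 / l\<^sup>2\<close> beyond.
\<close>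

definition returning_vector :: "(nat \<Rightarrow> 'a) \<Rightarrow> nat \<Rightarrow> nat \<Rightarrow> nat \<Rightarrow> (nat \<Rightarrow> 'a) \<Rightarrow> nat \<Rightarrow> 'a" where
  "returning_vector u a P T y l =
     (if l \<le> a then u l else if l < a + T * P then V ((l - a) mod P) * y ((l - a) mod P) / V l else 0)"

lemma norm_copy_le:
  assumes y: "\<And>l. J < l \<Longrightarrow> y l = 0" and l: "1 \<le> l"
  shows "norm (V j * y j / V l) \<le> (\<Sum>j\<le>J. norm (V j * y j)) / real l ^ 2"
proof -
  have "norm (V j * y j) \<le> (\<Sum>j\<le>J. norm (V j * y j))"
  proof (cases "j \<le> J")
    case True
    then show ?thesis by (intro member_le_sum) auto
  qed (use y in \<open>simp add: sum_nonneg\<close>)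
  then have "norm (V j * y j / V l) \<le> (\<Sum>j\<le>J. norm (V j * y j)) / norm (V l)"
    by (simp add: norm_divide divide_right_mono)
  also have "\<dots> \<le> (\<Sum>j\<le>J. norm (V j * y j)) / real l ^ 2"
    using l lower[OF l] by (intro divide_left_mono) (auto simp: sum_nonneg intro!: mult_pos_pos)
  finally show ?thesis .
qed

text \<open>
  The copies start after position \<open>a\<close> and are of size \<open>1 / l\<^sup>2\<close> there, whatever the spacing and the number
  of copies. So prescribed returns can be added to any \<open>u\<close> at an arbitrarily small cost.
\<close>

lemma returning_vector_close:
  assumes u: "u \<in> lp_space p" and r: "0 < r" and y: "\<And>l. J < l \<Longrightarrow> y l = 0"
  shows "\<exists>m0. \<forall>a\<ge>m0. \<forall>P T. returning_vector u a P T y \<in> lp_space p \<and>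
    lp_norm p (\<lambda>l. u l - returning_vector u a P T y l) < r"
proof -
  let ?C = "\<Sum>j\<le>J. norm (V j * y j)"
  have C: "0 \<le> ?C" by (simp add: sum_nonneg)
  obtain m0 where m0: "\<And>m x. m0 \<le> m \<Longrightarrow> \<forall>l\<le>m. x l = u l \<Longrightarrow> \<forall>l>m. norm (x l) \<le> ?C / real l ^ 2
      \<Longrightarrow> x \<in> lp_space p \<and> lp_norm p (\<lambda>l. u l - x l) < r"
    using lp_close_if_tail_decays[OF p C r u] by blast
  have "norm (returning_vector u a P T y l) \<le> ?C / real l ^ 2" if "a < l" for a P T l
    using that norm_copy_le[of J y l, OF y] by (simp add: returning_vector_def sum_nonneg)
  then show ?thesis by (intro exI[of _ m0] allI impI m0) (auto simp: returning_vector_def)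
qed

text \<open>
  The error of a return comes only from coordinates beyond \<open>P\<close>. Hence the spacing needed for a given
  accuracy depends on \<open>y\<close> alone, and this gives return times of a proportion independent of \<open>u\<close>, \<open>a\<close>, \<open>T\<close>.
\<close>

lemma returning_vector_returns:
  assumes y: "y 0 = 0" "\<And>l. J < l \<Longrightarrow> y l = 0" and e: "0 < e"
  shows "\<exists>P0. \<forall>P\<ge>P0. \<forall>u a T q. u 0 = 0 \<and> q < T \<longrightarrow>
    lp_norm p (\<lambda>l. (product_shift V ^^ (a + q * P)) (returning_vector u a P T y) l - y l) < e"
proof -
  let ?C = "\<Sum>j\<le>J. norm (V j * y j)"
  have C: "0 \<le> ?C" by (simp add: sum_nonneg)
  obtain m0 where m0: "\<And>m (x :: nat \<Rightarrow> 'a). m0 \<le> m \<Longrightarrow> \<forall>l\<le>m. x l = 0 \<Longrightarrow> \<forall>l>m. norm (x l) \<le> ?C / real l ^ 2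
      \<Longrightarrow> x \<in> lp_space p \<and> lp_norm p x < e"
    using inverse_square_decay_small[OF p C e] by blast
  have "lp_norm p (\<lambda>l. (product_shift V ^^ (a + q * P)) (returning_vector u a P T y) l - y l) < e"
    if P: "Suc (J + m0) \<le> P" and u: "u 0 = 0" and q: "q < T" for P u a T q
  proof -
    let ?x = "returning_vector u a P T y"
    define d where "d l = (product_shift V ^^ (a + q * P)) ?x l - y l" for l
    have it: "(product_shift V ^^ (a + q * P)) ?x l =
        (if l + q * P < T * P then V (l mod P) * y (l mod P) / V l else 0)" if l: "1 \<le> l" for l
      using l nonzero[of l] nonzero[of "l + (a + q * P)"]
      by (subst funpow_product_shift[OF l]) (auto simp: returning_vector_def)
    have small: "d l = 0" if "l \<le> P - 1" for l
    proof (cases "l = 0")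
      case True
      have "?x 0 = 0" using u by (simp add: returning_vector_def)
      then have "(product_shift V ^^ n) ?x 0 = 0" for n by (cases n) (auto simp: weighted_shift_def)
      then show ?thesis using True y(1) by (simp add: d_def)
    next
      case False
      have "l < P" using that P by auto
      moreover have "l + q * P < T * P"
        using \<open>l < P\<close> mult_le_mono1[of "Suc q" T P] q by simp
      ultimately show ?thesis using it[of l] False nonzero[of l] by (simp add: d_def)
    qed
    have large: "norm (d l) \<le> ?C / real l ^ 2" if "P - 1 < l" for l
    proof -
      have "y l = 0" using that P y(2) by auto
      then show ?thesis using that norm_copy_le[of J y l, OF y(2)] P
        by (simp add: d_def it sum_nonneg)
    qed
    \<comment> \<open>The error \<open>d\<close> vanishes below \<open>P\<close>, whence the index \<open>P - 1\<close>.\<close>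
    have "lp_norm p d < e" using m0[of "P - 1" d] small large P by auto
    then show ?thesis by (simp add: d_def[abs_def])
  qed
  then show ?thesis by blast
qed

end

section \<open>Hypercyclicity from fast growing products\<close>

definition list_vector :: "'a::real_normed_field list \<Rightarrow> nat \<Rightarrow> 'a" where
  "list_vector ys l = (if 1 \<le> l \<and> l \<le> length ys then ys ! (l - 1) else 0)"

lemma list_vector_0 [simp]: "list_vector ys 0 = 0"
  and list_vector_beyond: "length ys < l \<Longrightarrow> list_vector ys l = 0"
  by (auto simp: list_vector_def)

lemma list_vector_in_lp_space: "list_vector ys \<in> lp_space p"
  by (rule finite_support_in_lp_space[of _ "length ys"]) (auto simp: list_vector_beyond)

text \<open>
  If the ratio \<open>W\<^sub>l / V\<^sub>l\<close> at the copies of \<open>y\<close> is the entry \<open>d\<^sub>j\<close> of a pattern, then the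
  second shift sees the target \<open>z\<^sub>j = d\<^sub>j V\<^sub>j y\<^sub>j / W\<^sub>j\<close> where the first one sees \<open>y\<^sub>j\<close>.
  As long as no \<open>y\<^sub>j\<close> vanishes, the entries \<open>d\<^sub>j\<close> can be chosen after \<open>y\<close> so that \<open>z\<close> is close to
  any prescribed vector. For countable \<open>E\<close>, countably many patterns thus suffice to approximate all pairs of targets.
\<close>

lemma approximation_by_list_vectors:
  fixes V W :: "nat \<Rightarrow> 'a::real_normed_field"
  assumes p: "1 \<le> p" and E: "\<And>X. open X \<Longrightarrow> X \<noteq> {} \<Longrightarrow> \<exists>d\<in>E. d \<in> X" "0 \<notin> E"
    and VW: "\<And>l. 1 \<le> l \<Longrightarrow> V l \<noteq> 0" "\<And>l. 1 \<le> l \<Longrightarrow> W l \<noteq> 0"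
    and YZ: "Y \<in> lp_space p" "Z \<in> lp_space p" and e: "0 < e"
  shows "\<exists>ds\<in>lists (E \<times> E). lp_norm p (\<lambda>l. Y l - list_vector (map fst ds) l) < e \<and>
    lp_norm p (\<lambda>l. Z l - list_vector (map snd ds) l * (V l * list_vector (map fst ds) l / W l)) < e"
proof -
  obtain J1 \<eta>1 where 1: "0 < \<eta>1" "\<And>J z. J1 \<le> J \<Longrightarrow> z 0 = 0 \<Longrightarrow>
      \<forall>l\<in>{1..J}. norm (Y l - z l) \<le> \<eta>1 / real l ^ 2 \<Longrightarrow> \<forall>l>J. z l = 0 \<Longrightarrow> lp_norm p (\<lambda>l. Y l - z l) < e"
    using lp_close_if_coordinates_close[OF p e YZ(1)] by blast
  obtain J2 \<eta>2 where 2: "0 < \<eta>2" "\<And>J z. J2 \<le> J \<Longrightarrow> z 0 = 0 \<Longrightarrow>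
      \<forall>l\<in>{1..J}. norm (Z l - z l) \<le> \<eta>2 / real l ^ 2 \<Longrightarrow> \<forall>l>J. z l = 0 \<Longrightarrow> lp_norm p (\<lambda>l. Z l - z l) < e"
    using lp_close_if_coordinates_close[OF p e YZ(2)] by blast
  have "\<exists>a b. a \<in> E \<and> b \<in> E \<and> norm (Y l - a) \<le> \<eta>1 / real l ^ 2 \<and>
      norm (Z l - b * (V l * a / W l)) \<le> \<eta>2 / real l ^ 2" if l: "1 \<le> l" for l
  proof -
    have pos: "0 < \<eta>1 / real l ^ 2" "0 < \<eta>2 / real l ^ 2" using 1(1) 2(1) l by auto
    have "open (ball (Y l) (\<eta>1 / real l ^ 2))" "ball (Y l) (\<eta>1 / real l ^ 2) \<noteq> {}" using pos(1) by (simp_all only: open_ball ball_eq_empty not_le not_False_eq_True)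
    from E(1)[OF this] obtain a where a: "a \<in> E" "norm (Y l - a) < \<eta>1 / real l ^ 2" by (auto simp: dist_norm)
    define c where "c = V l * a / W l"
    have "a \<noteq> 0" using a E(2) by auto
    then have c: "c \<noteq> 0" using VW[OF l] by (simp add: c_def)
    have "open (ball (Z l / c) (\<eta>2 / real l ^ 2 / norm c))" "ball (Z l / c) (\<eta>2 / real l ^ 2 / norm c) \<noteq> {}"
      using divide_pos_pos[OF pos(2)] c by (simp_all only: open_ball ball_eq_empty not_le zero_less_norm_iff not_False_eq_True)
    from E(1)[OF this] obtain b where b: "b \<in> E" "norm (Z l / c - b) < \<eta>2 / real l ^ 2 / norm c"
      by (auto simp: dist_norm)
    have "Z l - b * c = (Z l / c - b) * c" using c by (simp add: field_simps)
    then have "norm (Z l - b * c) = norm (Z l / c - b) * norm c" by (simp add: norm_mult)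
    also have "\<dots> < \<eta>2 / real l ^ 2" using b(2) c by (metis pos_less_divide_eq zero_less_norm_iff)
    finally have "norm (Z l - b * (V l * a / W l)) \<le> \<eta>2 / real l ^ 2" unfolding c_def by (rule less_imp_le)
    then show ?thesis using a(1) less_imp_le[OF a(2)] b(1) by blast
  qed
  then obtain a b where ab: "\<And>l. 1 \<le> l \<Longrightarrow> a l \<in> E \<and> b l \<in> E \<and> norm (Y l - a l) \<le> \<eta>1 / real l ^ 2 \<and>
      norm (Z l - b l * (V l * a l / W l)) \<le> \<eta>2 / real l ^ 2" by metis
  define J where "J = max J1 J2"
  define ds where "ds = map (\<lambda>l. (a l, b l)) [1..<Suc J]"
  have fst: "list_vector (map fst ds) l = (if 1 \<le> l \<and> l \<le> J then a l else 0)" for l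
    by (auto simp: list_vector_def ds_def simp del: upt_Suc)
  have snd: "list_vector (map snd ds) l = (if 1 \<le> l \<and> l \<le> J then b l else 0)" for l
    by (auto simp: list_vector_def ds_def simp del: upt_Suc)
  have "ds \<in> lists (E \<times> E)" using ab by (auto simp: ds_def)
  moreover have "lp_norm p (\<lambda>l. Y l - list_vector (map fst ds) l) < e"
    by (rule 1(2)[of J]) (use ab in \<open>auto simp: fst J_def\<close>)
  moreover have "lp_norm p (\<lambda>l. Z l - list_vector (map snd ds) l * (V l * list_vector (map fst ds) l / W l)) < e"
    by (rule 2(2)[of J]) (use ab in \<open>auto simp: fst snd J_def\<close>)
  ultimately show ?thesis by blast
qed

lemma exists_countable_dense_nonzero:
  "\<exists>E :: 'a::{real_normed_field, second_countable_topology} set.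
     countable E \<and> 0 \<notin> E \<and> (\<forall>X. open X \<longrightarrow> X \<noteq> {} \<longrightarrow> (\<exists>d\<in>E. d \<in> X))"
proof -
  obtain D :: "'a set" where D: "countable D" "\<And>X. open X \<Longrightarrow> X \<noteq> {} \<Longrightarrow> \<exists>d\<in>D. d \<in> X"
    using countable_dense_setE by blast
  \<comment> \<open>Singletons are not open, so removing \<open>0\<close> preserves density.\<close>
  have "\<exists>d\<in>D - {0}. d \<in> X" if X: "open X" "X \<noteq> {}" for X
  proof -
    have "X \<noteq> {0}" using X(1) not_open_singleton by metis
    then have "open (X - {0})" "X - {0} \<noteq> {}" using X by (auto simp: open_delete)
    then show ?thesis using D(2) by blast
  qed
  then show ?thesis using D(1) by (intro exI[of _ "D - {0}"]) auto
qed

lemma open_contains_lp_balls: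
  assumes p: "1 \<le> p" and U: "openin (lp_topology p) U" "x \<in> U"
  shows "\<exists>e>0. \<forall>y\<in>lp_space p. lp_norm p (\<lambda>l. x l - y l) < e \<longrightarrow>
    {z \<in> lp_space p. lp_norm p (\<lambda>l. z l - y l) < e} \<subseteq> U"
proof -
  interpret Metric_space "lp_space p :: (nat \<Rightarrow> 'a) set" "lp_dist p"
    by (rule Metric_space_lp[OF p])
  obtain r where x: "x \<in> lp_space p" and r: "0 < r"
      "\<And>z. z \<in> lp_space p \<Longrightarrow> lp_norm p (\<lambda>n. x n - z n) < r \<Longrightarrow> z \<in> U"
    using U unfolding openin_lp_topology[OF p] by blast
  have "z \<in> U" if y: "y \<in> lp_space p" "lp_norm p (\<lambda>l. x l - y l) < r / 2"
    and z: "z \<in> lp_space p" "lp_norm p (\<lambda>l. z l - y l) < r / 2" for y z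
    using triangle[OF x y(1) z(1)] commute[of z y] y(2) z(2) by (intro r(2) z(1)) (simp add: lp_dist_def)
  then show ?thesis using r(1) by (intro exI[of _ "r / 2"]) auto
qed

lemma map_in_lists_if_in_lists_Times:
  "ds \<in> lists (A \<times> B) \<Longrightarrow> map fst ds \<in> lists A \<and> map snd ds \<in> lists B"
  by (induction ds) auto

lemma card_progression:
  assumes "1 \<le> (P::nat)"
  shows "card ((\<lambda>q. a + q * P) ` {..<T}) = T"
  using assms by (subst card_image) (auto simp: inj_on_def)

lemma progression_subset:
  fixes a P :: nat
  assumes "1 \<le> P"
  shows "(\<lambda>q. a + q * P) ` {..<T} \<subseteq> {a..<a + T * P}"
  using assms by auto

context shift_products
begin

text \<open>
  Copies of \<open>y\<close> may be put at all positions \<open>a + q P\<close> with \<open>q < T\<close>. For \<open>T \<ge> a\<close> these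
  make up a proportion at least \<open>1 / (2 P)\<close> of \<open>{1..a + T P}\<close>, which is the bound required by the Baire
  category argument.
\<close>

theorem upper_freq_hypercyclic_product_shift:
  "upper_freq_hypercyclic (lp_topology p) (product_shift V)"
proof -
  let ?B = "product_shift V"
  obtain E :: "'a set" where E: "countable E" "0 \<notin> E" "\<And>X. open X \<Longrightarrow> X \<noteq> {} \<Longrightarrow> \<exists>d\<in>E. d \<in> X"
    using exists_countable_dense_nonzero by blast
  define G where "G i = {x \<in> lp_space p. lp_norm p (\<lambda>l. x l - list_vector (fst i) l) < inverse (real (Suc (snd i)))}"
    for i :: "'a list \<times> nat"
  define P where "P i n = {x \<in> lp_space p. (?B ^^ n) x \<in> G i}" for i n
  have "\<exists>x\<in>topspace (lp_topology p). \<forall>i\<in>lists E \<times> UNIV. \<exists>\<delta>>0. \<forall>m. \<exists>S\<in>initial_windows \<delta> m. \<forall>n\<in>S. x \<in> P i n"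
  proof (rule Baire_return_times[OF completely_metrizable_lp_topology[OF p]])
    show "topspace (lp_topology p :: (nat \<Rightarrow> 'a) topology) \<noteq> {}"
      unfolding topspace_lp_topology[OF p] using zero_in_lp_space by blast
    show "countable (lists E \<times> (UNIV :: nat set))" using E(1) by auto
    show "openin (lp_topology p) (P i n)" for i n
      unfolding P_def G_def
      by (intro openin_vimage_funpow_weighted_shift[OF p norm_weights_le] openin_lp_ball p list_vector_in_lp_space)
    show "finite S" if "S \<in> initial_windows \<delta> m" for \<delta> m S using that by (rule finite_initial_windows)
    fix i :: "'a list \<times> nat"
    define y where "y = list_vector (fst i)"
    have y: "y 0 = 0" "\<And>l. length (fst i) < l \<Longrightarrow> y l = 0" by (auto simp: y_def list_vector_beyond)
    have e: "0 < inverse (real (Suc (snd i)))" by simp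
    obtain P0 where P0: "\<And>N u a T q. P0 \<le> N \<Longrightarrow> u 0 = 0 \<Longrightarrow> q < T \<Longrightarrow>
        lp_norm p (\<lambda>l. (?B ^^ (a + q * N)) (returning_vector u a N T y) l - y l) < inverse (real (Suc (snd i)))"
      using returning_vector_returns[where y = y, OF y e] by blast
    define N where "N = max P0 1"
    have N: "P0 \<le> N" "1 \<le> N" by (auto simp: N_def)
    define \<delta> where "\<delta> = 1 / (2 * real N)"
    have \<delta>: "0 < \<delta>" using N by (simp add: \<delta>_def)
    have "\<exists>S\<in>initial_windows \<delta> m. \<exists>x\<in>U. \<forall>n\<in>S. x \<in> P i n"
      if U: "openin (lp_topology p) U" "U \<noteq> {}" for U m
    proof -
      obtain u where "u \<in> U" using U(2) by blast
      then have u: "u \<in> lp_space p" and "\<exists>r>0. \<forall>x\<in>lp_space p. lp_norm p (\<lambda>n. u n - x n) < r \<longrightarrow> x \<in> U"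
        using U(1) unfolding openin_lp_topology[OF p] by auto
      then obtain r where r: "0 < r" "\<And>x. x \<in> lp_space p \<Longrightarrow> lp_norm p (\<lambda>n. u n - x n) < r \<Longrightarrow> x \<in> U"
        by blast
      obtain m0 where m0: "\<And>a N T. m0 \<le> a \<Longrightarrow> returning_vector u a N T y \<in> lp_space p \<and>
          lp_norm p (\<lambda>l. u l - returning_vector u a N T y l) < r"
        using returning_vector_close[where y = y, OF u r(1) y(2)] by blast
      define a where "a = Suc m0"
      \<comment> \<open>At least \<open>a\<close> copies outweigh the part of the window before the first one.\<close>
      define T where "T = a + m"
      define x where "x = returning_vector u a N T y"
      define S where "S = (\<lambda>q. a + q * N) ` {..<T}"
      have x: "x \<in> lp_space p" "x \<in> U" using m0[of a N T] r(2) by (auto simp: x_def a_def)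
      have "x \<in> P i n" if "n \<in> S" for n
      proof -
        obtain q where q: "q < T" "n = a + q * N" using \<open>n \<in> S\<close> by (auto simp: S_def)
        have "u 0 = 0" using u by (simp add: lp_space_def)
        from P0[where N = N and u = u and a = a and T = T and q = q, OF N(1) this q(1)] show ?thesis
          using funpow_in_lp_space[OF x(1)] x(1) by (simp add: P_def G_def q(2) x_def y_def)
      qed
      moreover have "S \<in> initial_windows \<delta> m"
        unfolding initial_windows_def
      proof (intro CollectI exI conjI)
        have TN: "T \<le> T * N" using N by simp
        moreover have "m \<le> T" by (simp add: T_def)
        ultimately show "m \<le> a + T * N" by linarith
        show "S \<subseteq> {1..a + T * N}"
          using progression_subset[OF N(2), of a T] unfolding S_def a_def by auto
        have "a \<le> T" by (simp add: T_def)
        then have "a \<le> T * N" using TN by linarith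
        then have "real a \<le> real T * real N" by (metis of_nat_le_iff of_nat_mult)
        then have "\<delta> * real (a + T * N) \<le> real T" using N by (simp add: \<delta>_def field_simps)
        then show "\<delta> * real (a + T * N) \<le> real (card S)" by (simp add: S_def card_progression[OF N(2)])
      qed
      ultimately show ?thesis using x(2) by blast
    qed
    then show "\<exists>\<delta>>0. \<forall>U m. openin (lp_topology p) U \<and> U \<noteq> {} \<longrightarrow>
        (\<exists>S\<in>initial_windows \<delta> m. \<exists>x\<in>U. \<forall>n\<in>S. x \<in> P i n)" using \<delta> by blast
  qed
  then obtain x where x: "x \<in> topspace (lp_topology p)" "\<And>i. i \<in> lists E \<times> UNIV \<Longrightarrow>
      \<exists>\<delta>>0. \<forall>m. \<exists>S\<in>initial_windows \<delta> m. \<forall>n\<in>S. x \<in> P i n" by blast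
  have "0 < upper_density {n. (?B ^^ n) x \<in> U}" if U: "openin (lp_topology p) U" "U \<noteq> {}" for U
  proof -
    obtain z where "z \<in> U" using U(2) by blast
    then have z: "z \<in> lp_space p" using openin_subset[OF U(1)] unfolding topspace_lp_topology[OF p] by blast
    obtain e where e: "0 < e" "\<And>y. y \<in> lp_space p \<Longrightarrow> lp_norm p (\<lambda>l. z l - y l) < e \<Longrightarrow>
        {x \<in> lp_space p. lp_norm p (\<lambda>l. x l - y l) < e} \<subseteq> U"
      using open_contains_lp_balls[OF p U(1) \<open>z \<in> U\<close>] by blast
    obtain ds where ds: "ds \<in> lists (E \<times> E)" "lp_norm p (\<lambda>l. z l - list_vector (map fst ds) l) < e"
      using approximation_by_list_vectors[of p E V V z z e, OF p E(3,2) nonzero nonzero z z e(1)] by blast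
    obtain k where k: "inverse (real (Suc k)) < e" using reals_Archimedean[OF e(1)] by blast
    have i: "(map fst ds, k) \<in> lists E \<times> UNIV" using map_in_lists_if_in_lists_Times[OF ds(1)] by simp
    have "G (map fst ds, k) \<subseteq> U"
      using e(2)[OF list_vector_in_lp_space ds(2)] k unfolding G_def fst_conv snd_conv
      by (blast intro: less_trans)
    then have sub: "P (map fst ds, k) n \<subseteq> {x. (?B ^^ n) x \<in> U}" for n by (auto simp: P_def)
    obtain \<delta> where "\<delta> > 0" and S: "\<And>m. \<exists>S\<in>initial_windows \<delta> m. \<forall>n\<in>S. x \<in> P (map fst ds, k) n"
      using x(2)[OF i] by blast
    show ?thesis
    proof (rule upper_density_pos[OF \<open>\<delta> > 0\<close>])
      show "\<exists>S\<in>initial_windows \<delta> m. S \<subseteq> {n. (?B ^^ n) x \<in> U}" for m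
        using S[of m] sub by blast
    qed
  qed
  then show ?thesis using x(1) unfolding upper_freq_hypercyclic_def by blast
qed

end

text \<open>
  Where the pattern \<open>ds\<close> is realised, one vector contains the copies of \<open>y\<close> needed by the first
  shift and, at the same places, the copies of \<open>z\<close> needed by the second, because
  \<open>V\<^sub>j y\<^sub>j / V\<^sub>l = W\<^sub>j z\<^sub>j / W\<^sub>l\<close>. The pattern is available only at \<open>a + q L\<close> with \<open>q \<le> K\<close>, where
  \<open>a\<close> may be much larger than \<open>K L\<close>. A window that starts at \<open>a\<close> still contains a fixed proportion of return
  times, an initial window need not; so the argument yields upper Banach density.
\<close>

theorem disjoint_reiteratively_hypercyclic_product_shifts:
  assumes V: "shift_products p V" and W: "shift_products p W"
    and E: "countable E" "0 \<notin> E" "\<And>X. open X \<Longrightarrow> X \<noteq> {} \<Longrightarrow> \<exists>d\<in>E. d \<in> X"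
    and pattern: "\<And>ds. ds \<in> lists E \<Longrightarrow> \<exists>L\<ge>1. \<forall>K. \<exists>a\<ge>K. \<forall>q\<le>K. \<forall>j\<in>{1..length ds}.
      W (a + q * L + j) = ds ! (j - 1) * V (a + q * L + j)"
  shows "disjoint_reiteratively_hypercyclic (lp_topology p) (product_shift V) (product_shift W)"
proof -
  interpret V: shift_products p V by (rule V)
  interpret W: shift_products p W by (rule W)
  note p = V.p
  let ?B = "product_shift V" and ?C = "product_shift W"
  define y where "y i = list_vector (map fst (fst i))" for i :: "('a \<times> 'a) list \<times> nat"
  define z where "z i l = list_vector (map snd (fst i)) l * (V l * y i l / W l)" for i :: "('a \<times> 'a) list \<times> nat" and l
  have y: "y i 0 = 0" "\<And>l. length (fst i) < l \<Longrightarrow> y i l = 0"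
    and z: "z i 0 = 0" "\<And>l. length (fst i) < l \<Longrightarrow> z i l = 0" for i
    by (auto simp: y_def z_def list_vector_beyond)
  have y_lp: "y i \<in> lp_space p" and z_lp: "z i \<in> lp_space p" for i
    by (auto intro!: finite_support_in_lp_space[of _ "length (fst i)"] simp: y z)
  define G where "G i = {x \<in> lp_space p. lp_norm p (\<lambda>l. x l - y i l) < inverse (real (Suc (snd i)))}" for i
  define H where "H i = {x \<in> lp_space p. lp_norm p (\<lambda>l. x l - z i l) < inverse (real (Suc (snd i)))}" for i
  define P where "P i n = {x \<in> lp_space p. (?B ^^ n) x \<in> G i} \<inter> {x \<in> lp_space p. (?C ^^ n) x \<in> H i}" for i n
  have "\<exists>x\<in>topspace (lp_topology p). \<forall>i\<in>lists (E \<times> E) \<times> UNIV. \<exists>\<delta>>0. \<forall>m. \<exists>S\<in>shifted_windows \<delta> m. \<forall>n\<in>S. x \<in> P i n"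
  proof (rule Baire_return_times[OF completely_metrizable_lp_topology[OF p]])
    show "topspace (lp_topology p :: (nat \<Rightarrow> 'a) topology) \<noteq> {}"
      unfolding topspace_lp_topology[OF p] using zero_in_lp_space by blast
    show "countable (lists (E \<times> E) \<times> (UNIV :: nat set))" using E(1) by auto
    show "openin (lp_topology p) (P i n)" for i n
      unfolding P_def G_def H_def
      by (intro openin_Int openin_vimage_funpow_weighted_shift[OF p V.norm_weights_le]
        openin_vimage_funpow_weighted_shift[OF p W.norm_weights_le] openin_lp_ball p y_lp z_lp)
    show "finite S" if "S \<in> shifted_windows \<delta> m" for \<delta> m S using that by (rule finite_shifted_windows)
    fix i assume i: "i \<in> lists (E \<times> E) \<times> (UNIV :: nat set)"
    have "map snd (fst i) \<in> lists E" using map_in_lists_if_in_lists_Times[of "fst i" E E] i by (simp only: mem_Times_iff)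
    from pattern[OF this] obtain L where L: "1 \<le> L" "\<And>K. \<exists>a\<ge>K. \<forall>q\<le>K. \<forall>j\<in>{1..length (fst i)}.
        W (a + q * L + j) = map snd (fst i) ! (j - 1) * V (a + q * L + j)"
      by auto
    have e: "0 < inverse (real (Suc (snd i)))" by simp
    obtain P1 where P1: "\<And>N u a T q. P1 \<le> N \<Longrightarrow> u 0 = 0 \<Longrightarrow> q < T \<Longrightarrow>
        lp_norm p (\<lambda>l. (?B ^^ (a + q * N)) (V.returning_vector u a N T (y i)) l - y i l) < inverse (real (Suc (snd i)))"
      using V.returning_vector_returns[where y = "y i", OF y e] by blast
    obtain P2 where P2: "\<And>N u a T q. P2 \<le> N \<Longrightarrow> u 0 = 0 \<Longrightarrow> q < T \<Longrightarrow>
        lp_norm p (\<lambda>l. (?C ^^ (a + q * N)) (W.returning_vector u a N T (z i)) l - z i l) < inverse (real (Suc (snd i)))"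
      using W.returning_vector_returns[where y = "z i", OF z e] by blast
    \<comment> \<open>A multiple of the period \<open>L\<close> of the pattern that serves both shifts.\<close>
    define c where "c = Suc (P1 + P2 + length (fst i))"
    define N where "N = c * L"
    have "c \<le> N" using L(1) by (simp add: N_def)
    then have N: "P1 \<le> N" "P2 \<le> N" "1 \<le> N" "length (fst i) < N" by (auto simp: c_def)
    define \<delta> where "\<delta> = 1 / real N"
    have \<delta>: "0 < \<delta>" using N(3) by (simp add: \<delta>_def)
    have "\<exists>S\<in>shifted_windows \<delta> m. \<exists>x\<in>U. \<forall>n\<in>S. x \<in> P i n"
      if U: "openin (lp_topology p) U" "U \<noteq> {}" for U m
    proof -
      obtain u where "u \<in> U" using U(2) by blast
      then have u: "u \<in> lp_space p" and "\<exists>r>0. \<forall>x\<in>lp_space p. lp_norm p (\<lambda>n. u n - x n) < r \<longrightarrow> x \<in> U"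
        using U(1) unfolding openin_lp_topology[OF p] by auto
      then obtain r where r: "0 < r" "\<And>x. x \<in> lp_space p \<Longrightarrow> lp_norm p (\<lambda>n. u n - x n) < r \<Longrightarrow> x \<in> U"
        by blast
      have u0: "u 0 = 0" using u by (simp add: lp_space_def)
      obtain m0 where m0: "\<And>a N T. m0 \<le> a \<Longrightarrow> V.returning_vector u a N T (y i) \<in> lp_space p \<and>
          lp_norm p (\<lambda>l. u l - V.returning_vector u a N T (y i) l) < r"
        using V.returning_vector_close[where y = "y i", OF u r(1) y(2)] by blast
      define T where "T = Suc m"
      obtain a where a: "m0 + 2 + T * c \<le> a" "\<And>q j. q \<le> m0 + 2 + T * c \<Longrightarrow> j \<in> {1..length (fst i)} \<Longrightarrow>
          W (a + q * L + j) = map snd (fst i) ! (j - 1) * V (a + q * L + j)"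
        using L(2) by blast
      define x where "x = V.returning_vector u a N T (y i)"
      define S where "S = (\<lambda>q. a + q * N) ` {..<T}"
      have x: "x \<in> lp_space p" "x \<in> U" using m0[of a N T] r(2) a(1) by (auto simp: x_def)
      have xW: "x = W.returning_vector u a N T (z i)"
      proof
        fix l
        show "x l = W.returning_vector u a N T (z i) l"
        proof (cases "a < l \<and> l < a + T * N")
          case True
          define j q where "j = (l - a) mod N" and "q = (l - a) div N"
          have l: "l = a + (q * c) * L + j"
            using True div_mult_mod_eq[of "l - a" N] by (simp add: j_def q_def N_def algebra_simps)
          have "l - a < T * N" using True by linarith
          then have "q < T" by (simp add: q_def less_mult_imp_div_less)
          then have "q * c \<le> T * c" by (intro mult_le_mono1) simp
          then have q: "q * c \<le> m0 + 2 + T * c" by linarith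
          have nz: "V l \<noteq> 0" "W l \<noteq> 0" using V.nonzero[of l] W.nonzero[of l] True by auto
          have "V j * y i j / V l = W j * z i j / W l"
          proof (cases "j \<in> {1..length (fst i)}")
            case True
            have "W l = map snd (fst i) ! (j - 1) * V l" unfolding l by (rule a(2)[OF q True])
            moreover have "list_vector (map snd (fst i)) j = map snd (fst i) ! (j - 1)"
              using True by (simp add: list_vector_def)
            ultimately show ?thesis using nz V.nonzero[of j] W.nonzero[of j] True by (simp add: z_def field_simps)
          next
            case False
            then have "j = 0 \<or> length (fst i) < j" by auto
            then have "y i j = 0" "z i j = 0" using y(1)[of i] y(2)[of i j] z(1)[of i] z(2)[of i j] by auto
            then show ?thesis by simp
          qed
          then show ?thesis using True
            by (simp add: x_def V.returning_vector_def W.returning_vector_def j_def)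
        qed (auto simp: x_def V.returning_vector_def W.returning_vector_def)
      qed
      have "x \<in> P i n" if "n \<in> S" for n
      proof -
        obtain q where q: "q < T" "n = a + q * N" using \<open>n \<in> S\<close> by (auto simp: S_def)
        have "(?B ^^ n) x \<in> G i"
          using P1[where N = N and u = u and a = a and T = T and q = q, OF N(1) u0 q(1)] V.funpow_in_lp_space[OF x(1)] by (simp add: G_def q(2) x_def)
        moreover have "(?C ^^ n) x \<in> H i"
          using P2[where N = N and u = u and a = a and T = T and q = q, OF N(2) u0 q(1)] W.funpow_in_lp_space[OF x(1)] by (simp add: H_def q(2) xW)
        ultimately show ?thesis using x(1) by (simp add: P_def)
      qed
      moreover have "S \<in> shifted_windows \<delta> m"
        unfolding shifted_windows_def
      proof (intro CollectI exI conjI)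
        have "T \<le> T * N" using N(3) by simp
        then show "m \<le> T * N" by (simp add: T_def)
        show "1 \<le> a - 1" using a(1) by simp
        have "{a..<a + T * N} \<subseteq> {a - 1 + 1..a - 1 + T * N}" using a(1) by auto
        then show "S \<subseteq> {a - 1 + 1..a - 1 + T * N}"
          using progression_subset[OF N(3), of a T] unfolding S_def by (rule order_trans[rotated])
        show "\<delta> * real (T * N) \<le> real (card S)"
          using N(3) by (simp add: \<delta>_def S_def card_progression[OF N(3)])
      qed
      ultimately show ?thesis using x(2) by blast
    qed
    then show "\<exists>\<delta>>0. \<forall>U m. openin (lp_topology p) U \<and> U \<noteq> {} \<longrightarrow>
        (\<exists>S\<in>shifted_windows \<delta> m. \<exists>x\<in>U. \<forall>n\<in>S. x \<in> P i n)" using \<delta> by blast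
  qed
  then obtain x where x: "x \<in> topspace (lp_topology p)" "\<And>i. i \<in> lists (E \<times> E) \<times> UNIV \<Longrightarrow>
      \<exists>\<delta>>0. \<forall>m. \<exists>S\<in>shifted_windows \<delta> m. \<forall>n\<in>S. x \<in> P i n" by blast
  have "0 < upper_Banach_density {n. (?B ^^ n) x \<in> U1 \<and> (?C ^^ n) x \<in> U2}"
    if U: "openin (lp_topology p) U1" "U1 \<noteq> {}" "openin (lp_topology p) U2" "U2 \<noteq> {}" for U1 U2
  proof -
    obtain s t where st: "s \<in> U1" "t \<in> U2" using U by blast
    then have lp: "s \<in> lp_space p" "t \<in> lp_space p"
      using openin_subset[OF U(1)] openin_subset[OF U(3)] unfolding topspace_lp_topology[OF p] by auto
    obtain e1 where e1: "0 < e1" "\<And>y. y \<in> lp_space p \<Longrightarrow> lp_norm p (\<lambda>l. s l - y l) < e1 \<Longrightarrow>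
        {x \<in> lp_space p. lp_norm p (\<lambda>l. x l - y l) < e1} \<subseteq> U1"
      using open_contains_lp_balls[OF p U(1) st(1)] by blast
    obtain e2 where e2: "0 < e2" "\<And>y. y \<in> lp_space p \<Longrightarrow> lp_norm p (\<lambda>l. t l - y l) < e2 \<Longrightarrow>
        {x \<in> lp_space p. lp_norm p (\<lambda>l. x l - y l) < e2} \<subseteq> U2"
      using open_contains_lp_balls[OF p U(3) st(2)] by blast
    have e: "0 < min e1 e2" using e1(1) e2(1) by simp
    obtain ds where ds: "ds \<in> lists (E \<times> E)" "lp_norm p (\<lambda>l. s l - list_vector (map fst ds) l) < min e1 e2"
      "lp_norm p (\<lambda>l. t l - list_vector (map snd ds) l * (V l * list_vector (map fst ds) l / W l)) < min e1 e2"
      using approximation_by_list_vectors[of p E V W s t, OF p E(3,2) V.nonzero W.nonzero lp e] by blast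
    obtain k where k: "inverse (real (Suc k)) < min e1 e2" using reals_Archimedean[OF e] by blast
    define i where "i = (ds, k)"
    have i: "i \<in> lists (E \<times> E) \<times> UNIV" using ds(1) by (auto simp: i_def)
    have "G i \<subseteq> U1"
    proof -
      have "lp_norm p (\<lambda>l. s l - y i l) < e1" using ds(2) by (simp add: i_def y_def)
      from e1(2)[OF y_lp this] show ?thesis using k unfolding G_def i_def snd_conv by auto
    qed
    moreover have "H i \<subseteq> U2"
    proof -
      have "lp_norm p (\<lambda>l. t l - z i l) < e2" using ds(3) by (simp add: i_def y_def z_def)
      from e2(2)[OF z_lp this] show ?thesis using k unfolding H_def i_def snd_conv by auto
    qed
    ultimately have sub: "P i n \<subseteq> {x. (?B ^^ n) x \<in> U1 \<and> (?C ^^ n) x \<in> U2}" for n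
      by (auto simp: P_def)
    obtain \<delta> where "\<delta> > 0" and S: "\<And>m. \<exists>S\<in>shifted_windows \<delta> m. \<forall>n\<in>S. x \<in> P i n"
      using x(2)[OF i] by blast
    show ?thesis
    proof (rule upper_Banach_density_pos[OF \<open>\<delta> > 0\<close>])
      show "\<exists>S\<in>shifted_windows \<delta> m. S \<subseteq> {n. (?B ^^ n) x \<in> U1 \<and> (?C ^^ n) x \<in> U2}" for m
        using S[of m] sub by blast
    qed
  qed
  then show ?thesis using x(1) unfolding disjoint_reiteratively_hypercyclic_def by blast
qed

lemma basis_vec_in_lp_space:
  assumes "1 \<le> k"
  shows "(\<lambda>l. c * basis_vec k l) \<in> lp_space p"
  by (rule finite_support_in_lp_space[of _ k]) (use assms in \<open>auto simp: basis_vec_def\<close>)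

text \<open>
  At times \<open>n\<close> with \<open>W\<^sub>n\<^sub>+\<^sub>1 = V\<^sub>n\<^sub>+\<^sub>1\<close> both orbits have the same first coordinate, so they cannot
  be near \<open>e\<^sub>1\<close> and near \<open>3 e\<^sub>1\<close> simultaneously.
\<close>

theorem not_disjoint_upper_freq_hypercyclic_product_shifts:
  assumes V: "shift_products p V" and W: "shift_products p W" and VW: "W 1 = V 1"
    and dens: "upper_density {n. W (Suc n) \<noteq> V (Suc n)} \<le> 0"
  shows "\<not> disjoint_upper_freq_hypercyclic (lp_topology p) (product_shift V) (product_shift W)"
proof
  interpret V: shift_products p V by (rule V)
  interpret W: shift_products p W by (rule W)
  note p = V.p
  let ?B = "product_shift V" and ?C = "product_shift W"
  define U where "U c = {x \<in> lp_space p. lp_norm p (\<lambda>l. x l - c * basis_vec 1 l) < 1}" for c :: 'a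
  have Uc: "norm (x 1 - c) < 1" if "x \<in> U c" for x c
  proof -
    have "(\<lambda>l. x l - c * basis_vec 1 l) \<in> lp_space p"
      using that by (intro lp_space_diff[OF p] basis_vec_in_lp_space) (auto simp: U_def)
    from coordinate_le_lp_norm[OF p this, of 1] that show ?thesis
      by (simp add: U_def basis_vec_def)
  qed
  have "openin (lp_topology p) (U c) \<and> U c \<noteq> {}" for c
  proof
    show "openin (lp_topology p) (U c)"
      unfolding U_def by (intro openin_lp_ball p basis_vec_in_lp_space) simp
    have "(\<lambda>l. c * basis_vec 1 l) \<in> U c" using p basis_vec_in_lp_space[of 1] by (simp add: U_def lp_norm_def)
    then show "U c \<noteq> {}" by blast
  qed
  moreover assume "disjoint_upper_freq_hypercyclic (lp_topology p) ?B ?C"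
  ultimately obtain x where "0 < upper_density {n. (?B ^^ n) x \<in> U 1 \<and> (?C ^^ n) x \<in> U 3}" (is "_ < upper_density ?N")
    unfolding disjoint_upper_freq_hypercyclic_def by meson
  moreover have "?N \<subseteq> {n. W (Suc n) \<noteq> V (Suc n)}"
  proof clarify
    fix n assume n: "(?B ^^ n) x \<in> U 1" "(?C ^^ n) x \<in> U 3" "W (Suc n) = V (Suc n)"
    then have "(?B ^^ n) x 1 = (?C ^^ n) x 1"
      using VW by (simp add: V.funpow_product_shift W.funpow_product_shift)
    then have "norm ((?B ^^ n) x 1 - 1) < 1" "norm ((?B ^^ n) x 1 - 3) < 1"
      using Uc n(1,2) by fastforce+
    then have "norm (((?B ^^ n) x 1 - 1) - ((?B ^^ n) x 1 - 3)) < 2"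
      using norm_triangle_ineq4[of "(?B ^^ n) x 1 - 1" "(?B ^^ n) x 1 - 3"] by linarith
    then show False by simp
  qed
  then have "upper_density ?N \<le> upper_density {n. W (Suc n) \<noteq> V (Suc n)}"
    by (rule upper_density_mono)
  ultimately show False using dens by simp
qed

section \<open>Weights that realise prescribed patterns in sparse blocks\<close>

text \<open>
  The products will be \<open>n\<^sup>2\<close> times a correction factor that follows an admissible function inside a block and
  is \<open>1\<close> elsewhere. Factors may drop by any amount, so switching back to \<open>1\<close> is harmless at any moment;
  only the growth per step is limited. The condition \<open>f 0 = 1\<close> lets a block start.
\<close>

definition admissible :: "(nat \<Rightarrow> 'a::real_normed_field) \<Rightarrow> bool" where
  "admissible f \<longleftrightarrow> f 0 = 1 \<and> (\<forall>t. 1 \<le> norm (f t)) \<and> (\<forall>t. norm (f (Suc t)) \<le> 2 * norm (f t))"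

definition realises :: "'a::real_normed_field list \<Rightarrow> (nat \<Rightarrow> 'a) \<Rightarrow> (nat \<Rightarrow> 'a) \<Rightarrow> nat \<Rightarrow> nat \<Rightarrow> bool" where
  "realises ds f g s L \<longleftrightarrow>
     (\<forall>q. \<forall>j\<in>{1..length ds}. g (s + q * L + j) = ds ! (j - 1) * f (s + q * L + j))"

lemma admissible_periodic:
  fixes f :: "nat \<Rightarrow> 'a::real_normed_field"
  assumes f0: "f 0 = 1" and ge: "\<And>t. t < L \<Longrightarrow> 1 \<le> norm (f t)" and L: "1 \<le> L"
    and step: "\<And>t. Suc t < L \<Longrightarrow> norm (f (Suc t)) \<le> 2 * norm (f t)"
  shows "admissible (\<lambda>t. f (t mod L))"
  unfolding admissible_def
proof (intro conjI allI)
  have lt: "t mod L < L" for t using L by simp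
  show "1 \<le> norm (f (t mod L))" for t by (rule ge[OF lt])
  show "norm (f (Suc t mod L)) \<le> 2 * norm (f (t mod L))" for t
  proof (cases "Suc (t mod L) = L")
    case True
    then show ?thesis using ge[OF lt[of t]] f0 by (simp add: mod_Suc)
  next
    case False
    then show ?thesis using step[of "t mod L"] lt[of t] by (simp add: mod_Suc)
  qed
qed (use f0 in simp)

text \<open>
  One period consists of a ramp, where \<open>f = g = 2\<^sup>t\<close>, followed by the pattern, where \<open>g = d f\<close>. The entries
  \<open>d\<close> lie between \<open>1 / H\<close> and \<open>H\<close> in absolute value. If \<open>f\<close> decreases by the factor \<open>H\<^sup>2\<close> at each
  step of the pattern, then \<open>g\<close> does not increase there, whatever the entries are; the ramp is long enough
  to pay for the decrease, so neither function falls below \<open>1\<close>. The length of the period depends on the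
  pattern only.
\<close>

lemma exists_admissible_realising:
  fixes ds :: "'a::real_normed_field list"
  assumes ds: "0 \<notin> set ds"
  shows "\<exists>f g s L. admissible f \<and> admissible g \<and> 1 \<le> L \<and> realises ds f g s L"
proof -
  \<comment> \<open>A common bound for the entries and their inverses.\<close>
  define H where "H = 1 + (\<Sum>d\<leftarrow>ds. norm d + inverse (norm d))"
  define J where "J = length ds"
  have H: "norm d \<le> H \<and> inverse (norm d) \<le> H" if "d \<in> set ds" for d
  proof -
    have "norm d + inverse (norm d) \<le> (\<Sum>d\<leftarrow>ds. norm d + inverse (norm d))"
      using that by (intro member_le_sum_list) (auto intro!: add_nonneg_nonneg)
    moreover have "0 \<le> norm d" "0 \<le> inverse (norm d)" by simp_all
    ultimately show ?thesis unfolding H_def by linarith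
  qed
  have "0 \<le> (\<Sum>d\<leftarrow>ds. norm d + inverse (norm d))" by (intro sum_list_nonneg) auto
  then have H1: "1 \<le> H" by (simp add: H_def)
  obtain S where S: "H * H ^ (2 * J) \<le> 2 ^ S"
    using real_arch_pow[of 2 "H * H ^ (2 * J)"] by (auto intro: less_imp_le)
  define L where "L = Suc S + J"
  define b :: "nat \<Rightarrow> 'a" where
    "b t = (if t \<le> S then 2 ^ t else of_real (H ^ (2 * (L - t))))" for t
  define c :: "nat \<Rightarrow> 'a" where
    "c t = (if t \<le> S then 2 ^ t else ds ! (t - Suc S) * b t)" for t
  have nb: "norm (b t) = (if t \<le> S then 2 ^ t else H ^ (2 * (L - t)))" for t
    using H1 by (simp add: b_def norm_power)
  have nc: "norm (c t) = (if t \<le> S then 2 ^ t else norm (ds ! (t - Suc S)) * H ^ (2 * (L - t)))" for t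
    by (simp add: c_def nb norm_mult norm_power)
  have d: "norm (ds ! (t - Suc S)) \<le> H" "1 \<le> norm (ds ! (t - Suc S)) * H" if "S < t" "t < L" for t
  proof -
    have "ds ! (t - Suc S) \<in> set ds" using that by (intro nth_mem) (auto simp: L_def J_def)
    moreover from this ds have "0 < norm (ds ! (t - Suc S))" by auto
    ultimately show "norm (ds ! (t - Suc S)) \<le> H" "1 \<le> norm (ds ! (t - Suc S)) * H"
      using H[of "ds ! (t - Suc S)"] by (auto simp: field_simps)
  qed
  have "1 \<le> norm (b t)" for t using H1 by (simp add: nb one_le_power)
  moreover have c1: "1 \<le> norm (c t)" if "t < L" for t
  proof (cases "t \<le> S")
    case False
    have "H ^ 1 \<le> H ^ (2 * (L - t))" using H1 that by (intro power_increasing) auto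
    then have "norm (ds ! (t - Suc S)) * H \<le> norm (c t)"
      using False by (auto simp: nc intro!: mult_left_mono)
    then show ?thesis using d(2)[of t] False that by simp
  qed (simp add: nc)
  moreover have "norm (b (Suc t)) \<le> 2 * norm (b t)" if t: "Suc t < L" for t
  proof -
    consider "Suc t \<le> S" | "t = S" | "S < t" by linarith
    then show ?thesis
    proof cases
      case 2
      have "H ^ (2 * J) \<le> H * H ^ (2 * J)" using H1 by simp
      then have "H ^ (2 * J) \<le> 2 * 2 ^ S" using S zero_le_power[of "2::real" S] by linarith
      then show ?thesis using 2 by (simp add: nb L_def)
    next
      case 3
      have "H ^ (2 * (L - Suc t)) \<le> H ^ (2 * (L - t))" using H1 by (intro power_increasing) auto
      moreover have "0 \<le> H ^ (2 * (L - t))" using H1 by simp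
      ultimately have "H ^ (2 * (L - Suc t)) \<le> 2 * H ^ (2 * (L - t))" by linarith
      then show ?thesis using 3 by (simp add: nb)
    qed (simp add: nb)
  qed
  moreover have "norm (c (Suc t)) \<le> 2 * norm (c t)" if t: "Suc t < L" for t
  proof -
    consider "Suc t \<le> S" | "t = S" | "S < t" by linarith
    then show ?thesis
    proof cases
      case 2
      have "norm (ds ! 0) * H ^ (2 * J) \<le> H * H ^ (2 * J)"
        using d(1)[of "Suc t"] 2 t H1 by (intro mult_right_mono) auto
      then have "norm (ds ! 0) * H ^ (2 * J) \<le> 2 * 2 ^ S" using S zero_le_power[of "2::real" S] by linarith
      then show ?thesis using 2 by (simp add: nc L_def)
    next
      case 3
      have e: "2 * (L - t) = 2 * (L - Suc t) + 2" using t by simp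
      have "norm (ds ! (Suc t - Suc S)) \<le> H" using d(1)[of "Suc t"] 3 t by auto
      then have "norm (c (Suc t)) \<le> H * H ^ (2 * (L - Suc t))"
        using 3 H1 by (simp add: nc mult_right_mono)
      also have "\<dots> \<le> (norm (ds ! (t - Suc S)) * H) * (H * H ^ (2 * (L - Suc t)))"
        using mult_right_mono[of 1 "norm (ds ! (t - Suc S)) * H" "H * H ^ (2 * (L - Suc t))"]
          d(2)[of t] 3 t H1 by simp
      also have "\<dots> = norm (c t)" unfolding nc e using 3 by (simp add: power_add power2_eq_square)
      finally show ?thesis using c1[of t] t by simp
    qed (simp add: nc)
  qed
  ultimately have "admissible (\<lambda>t. b (t mod L))" "admissible (\<lambda>t. c (t mod L))"
    by (auto intro!: admissible_periodic simp: L_def b_def[of 0] c_def[of 0])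
  moreover have "realises ds (\<lambda>t. b (t mod L)) (\<lambda>t. c (t mod L)) S L"
  proof -
    have "(S + q * L + j) mod L = S + j" if "j \<in> {1..length ds}" for q j
    proof -
      have "S + q * L + j = (S + j) + q * L" by simp
      moreover have "S + j < L" using that by (simp add: L_def J_def)
      ultimately show ?thesis by (simp only: mod_mult_self1 mod_less)
    qed
    then show ?thesis by (auto simp: realises_def c_def)
  qed
  moreover have "1 \<le> L" by (simp add: L_def)
  ultimately show ?thesis by blast
qed

text \<open>
  The \<open>k\<close>-th block is \<open>[2\<^sup>k, 2\<^sup>k + k)\<close>. Its length tends to infinity, but the blocks together have
  density zero.
\<close>

definition block_insertion :: "(nat \<Rightarrow> nat \<Rightarrow> 'a::one) \<Rightarrow> nat \<Rightarrow> 'a" where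
  "block_insertion f n = (let k = floor_log n in if n - 2 ^ k < k then f k (n - 2 ^ k) else 1)"

lemma floor_log_eq:
  assumes "2 ^ k \<le> n" "n < 2 * 2 ^ k"
  shows "floor_log n = k"
proof (rule antisym)
  have "0 < n" using assms(1) by (cases n) auto
  then have "2 ^ floor_log n < (2::nat) ^ Suc k"
    using floor_log_exp2_le[of n] assms(2) by simp
  then show "floor_log n \<le> k" by (simp only: power_strict_increasing_iff less_Suc_eq_le)
  show "k \<le> floor_log n" using floor_log_le_iff[OF assms(1)] by simp
qed

lemma block_insertion_in_block:
  "t < k \<Longrightarrow> block_insertion f (2 ^ k + t) = f k t"
proof -
  assume "t < k"
  also have "k < 2 ^ k" by (rule less_exp)
  finally have "floor_log (2 ^ k + t) = k" by (intro floor_log_eq) auto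
  then show ?thesis using \<open>t < k\<close> by (simp add: block_insertion_def)
qed

lemma block_insertion_step:
  fixes f :: "nat \<Rightarrow> nat \<Rightarrow> 'a::real_normed_field"
  assumes f: "\<And>k. admissible (f k)"
  shows "1 \<le> norm (block_insertion f n)"
    "1 \<le> n \<Longrightarrow> norm (block_insertion f (Suc n)) \<le> 2 * norm (block_insertion f n)"
proof -
  have 1: "1 \<le> norm (f k t)" and 2: "norm (f k (Suc t)) \<le> 2 * norm (f k t)" and 0: "f k 0 = 1" for k t
    using f[of k] by (auto simp: admissible_def)
  show ge: "1 \<le> norm (block_insertion f n)" for n
    by (simp add: block_insertion_def Let_def 1)
  assume n: "1 \<le> n"
  define k where "k = floor_log n"
  have k: "2 ^ k \<le> n" "n < 2 * 2 ^ k" using floor_log_exp2_le[of n] floor_log_exp2_gt[of n] n by (auto simp: k_def)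
  show "norm (block_insertion f (Suc n)) \<le> 2 * norm (block_insertion f n)"
  proof (cases "Suc n = 2 * 2 ^ k")
    case True
    then have "floor_log (Suc n) = Suc k" by (intro floor_log_eq) auto
    then have "block_insertion f (Suc n) = 1" using True by (simp add: block_insertion_def 0)
    then show ?thesis using ge[of n] by simp
  next
    case False
    then have "floor_log (Suc n) = k" using k by (intro floor_log_eq) auto
    then show ?thesis using 2[of k "n - 2 ^ k"] ge[of n] k(1)
      by (auto simp: block_insertion_def k_def[symmetric] Suc_diff_le)
  qed
qed

text \<open>
  About \<open>log M\<close> blocks meet \<open>{1..M}\<close>, each of length at most about \<open>log M\<close>, and
  \<open>(log M)\<^sup>2 = o(M)\<close>.
\<close>

lemma upper_density_blocks_le_0:
  "upper_density {n. \<exists>k. \<exists>t<k. Suc n = 2 ^ k + t} \<le> 0"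
proof -
  let ?A = "{n. \<exists>k. \<exists>t<k. Suc n = 2 ^ k + t}"
  have le: "real (card (?A \<inter> {1..M})) / real M \<le> (log 2 (real M + 1) + 1) ^ 2 / real M" for M
  proof -
    define K where "K = floor_log (Suc M)"
    have "?A \<inter> {1..M} \<subseteq> (\<lambda>(k, t). 2 ^ k + t - 1) ` ({..K} \<times> {..<K})"
    proof clarify
      fix n k t assume n: "n \<in> {1..M}" "t < k" "Suc n = 2 ^ k + t"
      then have "2 ^ k \<le> Suc M" by auto
      then have "k \<le> K" unfolding K_def using floor_log_le_iff[of "2 ^ k" "Suc M"] by simp
      then show "n \<in> (\<lambda>(k, t). 2 ^ k + t - 1) ` ({..K} \<times> {..<K})"
        using n by (intro image_eqI[of _ _ "(k, t)"]) auto
    qed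
    then have "card (?A \<inter> {1..M}) \<le> card ((\<lambda>(k, t). 2 ^ k + t - 1) ` ({..K} \<times> {..<K}) :: nat set)"
      by (intro card_mono) auto
    also have "\<dots> \<le> card ({..K} \<times> {..<K})" by (rule card_image_le) auto
    also have "\<dots> \<le> (K + 1) ^ 2" by (simp add: power2_eq_square)
    finally have "real (card (?A \<inter> {1..M})) \<le> real ((K + 1) ^ 2)" by (simp only: of_nat_le_iff)
    then have "real (card (?A \<inter> {1..M})) \<le> (real K + 1) ^ 2" by (simp add: add.commute)
    moreover have "real K \<le> log 2 (real M + 1)"
    proof -
      have "real (2 ^ K) \<le> real (Suc M)"
        unfolding K_def of_nat_le_iff by (rule floor_log_exp2_le) simp
      then have "2 powr real K \<le> real M + 1" by (simp add: powr_realpow add.commute)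
      then show ?thesis by (subst le_log_iff) auto
    qed
    then have "(real K + 1) ^ 2 \<le> (log 2 (real M + 1) + 1) ^ 2" by (intro power_mono) auto
    ultimately have "real (card (?A \<inter> {1..M})) \<le> (log 2 (real M + 1) + 1) ^ 2" by (rule order_trans)
    then show ?thesis by (rule divide_right_mono) simp
  qed
  have "((\<lambda>M. (log 2 (real M + 1) + 1) ^ 2 / real M) \<longlongrightarrow> 0) sequentially" by real_asymp
  then have "limsup (\<lambda>M. ereal ((log 2 (real M + 1) + 1) ^ 2 / real M)) = 0"
    by (intro lim_imp_Limsup) (auto simp: zero_ereal_def)
  moreover have "upper_density ?A \<le> limsup (\<lambda>M. ereal ((log 2 (real M + 1) + 1) ^ 2 / real M))"
    unfolding upper_density_def using le by (intro Limsup_mono always_eventually allI) (simp only: ereal_less_eq)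
  ultimately show ?thesis by simp
qed

lemma shift_products_block_insertion:
  fixes f :: "nat \<Rightarrow> nat \<Rightarrow> 'a::{real_normed_field, banach, second_countable_topology}"
  assumes p: "1 \<le> p" and f: "\<And>k. admissible (f k)"
  shows "shift_products p (\<lambda>n. of_nat n ^ 2 * block_insertion f n)"
proof
  note ge = block_insertion_step(1)[of f, OF f] and step = block_insertion_step(2)[of f, OF f]
  show "real n ^ 2 \<le> norm (of_nat n ^ 2 * block_insertion f n)" for n
    using mult_left_mono[OF ge[of n], of "real n ^ 2"] by (simp add: norm_mult norm_power)
  show "norm (of_nat (Suc n) ^ 2 * block_insertion f (Suc n)) \<le> 8 * norm (of_nat n ^ 2 * block_insertion f n)"
    if n: "1 \<le> n" for n
  proof -
    have "real (Suc n) ^ 2 \<le> (2 * real n) ^ 2" using n by (intro power_mono) auto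
    then have "real (Suc n) ^ 2 * norm (block_insertion f (Suc n)) \<le> (2 * real n) ^ 2 * (2 * norm (block_insertion f n))"
      using step[OF n] by (intro mult_mono) auto
    then show ?thesis by (simp add: norm_mult norm_power power_mult_distrib del: of_nat_Suc)
  qed
qed (rule p)

text \<open>
  Every pattern over a countable dense set of nonzero scalars is assigned to infinitely many blocks. As the
  blocks become longer and the period of a pattern does not, each pattern is realised periodically
  arbitrarily often.
\<close>

theorem exists_disjoint_reiterative_not_upper_frequent:
  fixes p :: real
  assumes p: "1 \<le> p"
  shows "\<exists>v w :: nat \<Rightarrow> 'a::{real_normed_field, banach, second_countable_topology}.
    bounded (v ` {1..}) \<and> bounded (w ` {1..}) \<and>
    upper_freq_hypercyclic (lp_topology p) (weighted_shift v) \<and>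
    upper_freq_hypercyclic (lp_topology p) (weighted_shift w) \<and>
    disjoint_reiteratively_hypercyclic (lp_topology p) (weighted_shift v) (weighted_shift w) \<and>
    \<not> disjoint_upper_freq_hypercyclic (lp_topology p) (weighted_shift v) (weighted_shift w)"
proof -
  obtain E :: "'a set" where E: "countable E" "0 \<notin> E" "\<And>X. open X \<Longrightarrow> X \<noteq> {} \<Longrightarrow> \<exists>d\<in>E. d \<in> X"
    using exists_countable_dense_nonzero by blast
  have "\<forall>ds\<in>lists E. \<exists>f g s L. admissible f \<and> admissible g \<and> 1 \<le> L \<and> realises ds f g s L"
  proof
    fix ds assume "ds \<in> lists E"
    then have "0 \<notin> set ds" using E(2) by auto
    then show "\<exists>f g s L. admissible f \<and> admissible g \<and> 1 \<le> L \<and> realises ds f g s L"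
      by (rule exists_admissible_realising)
  qed
  then obtain F G s L where FG: "\<And>ds. ds \<in> lists E \<Longrightarrow>
      admissible (F ds) \<and> admissible (G ds) \<and> 1 \<le> L ds \<and> realises ds (F ds) (G ds) (s ds) (L ds)"
    by metis
  \<comment> \<open>The second component of \<open>prod_decode\<close> makes every pattern occur for arbitrarily large \<open>k\<close>.\<close>
  define enum where "enum k = from_nat_into (lists E) (fst (prod_decode k))" for k
  have ne: "lists E \<noteq> {}" by auto
  have enum: "enum k \<in> lists E" for k unfolding enum_def by (rule from_nat_into[OF ne])
  define f g where "f k = F (enum k)" and "g k = G (enum k)" for k
  have fg_adm: "admissible (f k)" "admissible (g k)" for k using FG[OF enum[of k]] by (auto simp: f_def g_def)
  define V W where "V n = of_nat n ^ 2 * block_insertion f n" and "W n = of_nat n ^ 2 * block_insertion g n" for n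
  interpret V: shift_products p V
    unfolding V_def[abs_def] by (rule shift_products_block_insertion[OF p fg_adm(1)])
  interpret W: shift_products p W
    unfolding W_def[abs_def] by (rule shift_products_block_insertion[OF p fg_adm(2)])
  have pattern: "\<exists>L\<ge>1. \<forall>K. \<exists>a\<ge>K. \<forall>q\<le>K. \<forall>j\<in>{1..length ds}.
      W (a + q * L + j) = ds ! (j - 1) * V (a + q * L + j)" if ds: "ds \<in> lists E" for ds
  proof (rule exI[of _ "L ds"], intro conjI allI)
    show "1 \<le> L ds" using FG[OF ds] by simp
    fix K
    obtain i where i: "from_nat_into (lists E) i = ds"
      using from_nat_into_surj[of "lists E" ds] E(1) ds by auto
    define k where "k = prod_encode (i, Suc (K + s ds + K * L ds + length ds))"
    have k: "K + s ds + K * L ds + length ds < k"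
      using le_prod_encode_2[of "Suc (K + s ds + K * L ds + length ds)" i] by (simp add: k_def)
    have "enum k = ds" by (simp add: enum_def k_def i)
    have "K \<le> 2 ^ k + s ds" using less_exp[of k] k by linarith
    moreover have "W (2 ^ k + s ds + q * L ds + j) = ds ! (j - 1) * V (2 ^ k + s ds + q * L ds + j)"
      if "q \<le> K" "j \<in> {1..length ds}" for q j
    proof -
      have "q * L ds \<le> K * L ds" "j \<le> length ds" using that by auto
      then have lt: "s ds + q * L ds + j < k" using k by linarith
      have "G ds (s ds + q * L ds + j) = ds ! (j - 1) * F ds (s ds + q * L ds + j)"
        using FG[OF ds] that(2) by (simp add: realises_def)
      then show ?thesis
        using block_insertion_in_block[OF lt, of f] block_insertion_in_block[OF lt, of g] \<open>enum k = ds\<close>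
        by (simp add: V_def W_def f_def g_def add.assoc)
    qed
    ultimately show "\<exists>a\<ge>K. \<forall>q\<le>K. \<forall>j\<in>{1..length ds}.
        W (a + q * L ds + j) = ds ! (j - 1) * V (a + q * L ds + j)" by blast
  qed
  have "W 1 = V 1" by (simp add: V_def W_def block_insertion_def)
  moreover have "upper_density {n. W (Suc n) \<noteq> V (Suc n)} \<le> 0"
  proof -
    have "{n. W (Suc n) \<noteq> V (Suc n)} \<subseteq> {n. \<exists>k. \<exists>t<k. Suc n = 2 ^ k + t}"
    proof (intro subsetI CollectI)
      fix n assume "n \<in> {n. W (Suc n) \<noteq> V (Suc n)}"
      then have "Suc n - 2 ^ floor_log (Suc n) < floor_log (Suc n)"
        by (auto simp: V_def W_def block_insertion_def Let_def split: if_splits)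
      moreover have "2 ^ floor_log (Suc n) \<le> Suc n" by (rule floor_log_exp2_le) simp
      ultimately show "\<exists>k. \<exists>t<k. Suc n = 2 ^ k + t"
        by (intro exI[of _ "floor_log (Suc n)"] exI[of _ "Suc n - 2 ^ floor_log (Suc n)"]) simp
    qed
    then have "upper_density {n. W (Suc n) \<noteq> V (Suc n)} \<le> upper_density {n. \<exists>k. \<exists>t<k. Suc n = 2 ^ k + t}"
      by (rule upper_density_mono)
    then show ?thesis using upper_density_blocks_le_0 by (rule order_trans)
  qed
  ultimately have "\<not> disjoint_upper_freq_hypercyclic (lp_topology p) (product_shift V) (product_shift W)"
    by (rule not_disjoint_upper_freq_hypercyclic_product_shifts[OF V.shift_products_axioms W.shift_products_axioms])
  moreover have "disjoint_reiteratively_hypercyclic (lp_topology p) (product_shift V) (product_shift W)"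
    by (rule disjoint_reiteratively_hypercyclic_product_shifts
      [OF V.shift_products_axioms W.shift_products_axioms E pattern])
  ultimately show ?thesis
    by (intro exI[of _ "product_weights V"] exI[of _ "product_weights W"] conjI V.bounded_weights W.bounded_weights
      V.upper_freq_hypercyclic_product_shift W.upper_freq_hypercyclic_product_shift)
qed

theorem theorem4p1:
  fixes p :: real
  assumes "1 \<le> p"
  shows "(\<exists>v w :: nat \<Rightarrow> real.
            bounded (v ` {1..}) \<and> bounded (w ` {1..}) \<and>
            upper_freq_hypercyclic (lp_topology p) (weighted_shift v) \<and>
            upper_freq_hypercyclic (lp_topology p) (weighted_shift w) \<and>
            disjoint_reiteratively_hypercyclic (lp_topology p) (weighted_shift v) (weighted_shift w) \<and>
            \<not> disjoint_upper_freq_hypercyclic (lp_topology p) (weighted_shift v) (weighted_shift w))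
       \<and> (\<exists>v w :: nat \<Rightarrow> complex.
            bounded (v ` {1..}) \<and> bounded (w ` {1..}) \<and>
            upper_freq_hypercyclic (lp_topology p) (weighted_shift v) \<and>
            upper_freq_hypercyclic (lp_topology p) (weighted_shift w) \<and>
            disjoint_reiteratively_hypercyclic (lp_topology p) (weighted_shift v) (weighted_shift w) \<and>
            \<not> disjoint_upper_freq_hypercyclic (lp_topology p) (weighted_shift v) (weighted_shift w))"
  by (intro conjI exists_disjoint_reiterative_not_upper_frequent[OF assms])

end
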